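(* Let $q\in\mathbb{Z}_{>0}$, let $\{\alpha_1,\dots,\alpha_q\}\subset\widehat{\mathbb{C}}$ be a set of distinct points and let $\mu_1,\dots,\mu_q\in\mathbb{Z}_{\ge2}\cup\{\infty\}$ satisfy $$\gamma:=\sum_{j=1}^q\left(1-\frac1{\mu_j}\right)>2 .$$ Let $\mathbb{D}=\{z\in\mathbb{C}:|z|<1\}$. If a holomorphic map $g:\mathbb{D}\setminus\{0\}\to\widehat{\mathbb{C}}$ satisfies the condition that each $\alpha_j$ ($1\le j\le q$) is a totally ramified value of $g$ of order $\mu_j$, then the puncture $z=0$ is not an essential singularity of $g$.
   Context: $\widehat{\mathbb{C}}=\mathbb{C}\cup\{\infty\}$ and $1/\infty:=0$. Let $\mu\in\mathbb{Z}_{\ge2}\cup\{\infty\}$ and let $g:\Sigma\to\widehat{\mathbb{C}}$ be a holomorphic map on a Riemann surface $\Sigma$. A point $\alpha\in\widehat{\mathbb{C}}$ is a totally ramified value of $g$ of order $\mu$ if the equation $g=\alpha$ has no root of multiplicity less than $\mu$ on $\Sigma$ (for $\alpha=\infty$ the multiplicity of a root is the order of the pole). An omitted value of $g$ is regarded as a totally ramified value of order $\infty$; thus for $\mu=\infty$ the condition means that $\alpha$ is omitted. That $z=0$ is not an essential singularity of $g$ means that $g$ extends to a holomorphic map $\mathbb{D}\to\widehat{\mathbb{C}}$. *)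

theory Defs
  imports "HOL-Complex_Analysis.Complex_Analysis"
begin

datatype riemann_sphere = Cplx complex | Infty

text \<open>The two standard charts of the sphere.  The affine chart is meaningful off \<open>Infty\<close>
  and the chart at infinity off \<open>Cplx 0\<close>; the values at those two points are dummies.\<close>

primrec affine_chart :: "riemann_sphere \<Rightarrow> complex" where
  "affine_chart (Cplx w) = w"
| "affine_chart Infty = 0"

primrec infty_chart :: "riemann_sphere \<Rightarrow> complex" where
  "infty_chart (Cplx w) = inverse w"
| "infty_chart Infty = 0"

text \<open>Holomorphy as a map into the Riemann surface given by these charts.  Continuity need not be
  required separately, since around each point the whole of some neighbourhood is mapped into the
  domain of a single chart.  A map that is identically \<open>Infty\<close> counts as holomorphic.\<close>

definition sphere_holomorphic_on :: "(complex \<Rightarrow> riemann_sphere) \<Rightarrow> complex set \<Rightarrow> bool" where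
  "sphere_holomorphic_on g S \<longleftrightarrow>
     (\<forall>z\<in>S. \<exists>U. open U \<and> z \<in> U \<and> U \<subseteq> S \<and>
        ((Infty \<notin> g ` U \<and> (\<lambda>w. affine_chart (g w)) holomorphic_on U) \<or>
         (Cplx 0 \<notin> g ` U \<and> (\<lambda>w. infty_chart (g w)) holomorphic_on U)))"

text \<open>Multiplicity of a root \<open>z\<close> of the equation \<open>g = \<alpha>\<close>; only meaningful if \<open>g z = \<alpha>\<close>.
  If \<open>g\<close> is constantly \<open>\<alpha>\<close> near \<open>z\<close>, where \<open>zorder\<close> is unspecified, the multiplicity is
  infinite.  The order of a pole is the negative of \<open>zorder\<close>, which does not depend on the (dummy)
  value at the pole itself.\<close>

definition root_multiplicity :: "(complex \<Rightarrow> riemann_sphere) \<Rightarrow> riemann_sphere \<Rightarrow> complex \<Rightarrow> enat" where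
  "root_multiplicity g \<alpha> z =
     (if \<forall>\<^sub>F w in at z. g w = \<alpha> then \<infinity>
      else case \<alpha> of
             Cplx a \<Rightarrow> enat (nat (zorder (\<lambda>w. affine_chart (g w) - a) z))
           | Infty \<Rightarrow> enat (nat (- zorder (\<lambda>w. affine_chart (g w)) z)))"

text \<open>Order \<open>\<infinity>\<close> means that the value is omitted.  This is a separate case because of the constant map
  \<open>g = \<alpha>\<close>, which has no root of finite multiplicity but does not omit \<open>\<alpha>\<close>.\<close>

definition totally_ramified_value ::
    "(complex \<Rightarrow> riemann_sphere) \<Rightarrow> complex set \<Rightarrow> riemann_sphere \<Rightarrow> enat \<Rightarrow> bool" where
  "totally_ramified_value g S \<alpha> \<mu> \<longleftrightarrow>
     (if \<mu> = \<infinity> then \<forall>z\<in>S. g z \<noteq> \<alpha>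
      else \<not> (\<exists>z\<in>S. g z = \<alpha> \<and> root_multiplicity g \<alpha> z < \<mu>))"

definition not_essential_puncture :: "(complex \<Rightarrow> riemann_sphere) \<Rightarrow> bool" where
  "not_essential_puncture g \<longleftrightarrow>
     (\<exists>h. sphere_holomorphic_on h (ball 0 1) \<and> (\<forall>z\<in>ball 0 1 - {0}. h z = g z))"

end

(*  For weights b_a < 1 - 1/mu_a with total > 2 there is a conformal metric of curvature bounded above
    by a negative constant on the sphere minus the ramified values, behaving like |w - a|^(-b_a) at a.
    Since a root of g = a has multiplicity at least mu_a, the pullback of this metric under g tends to 0
    at the roots, so Ahlfors' form of the Schwarz lemma applies.  Applied on the left half plane, which
    covers the punctured disc by exp, it shows that the circles |z| = r have images of length O(1 / log (1/r)).
    If g accumulates at a finite point p but does not converge to it, there are annuli around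
    small circles whose interior meets g near p, while the two boundary circles are mapped near points
    at a fixed distance from p; the maximum modulus principle excludes this.  *)

theory Submission
  imports Defs
begin

section \<open>A negatively curved conical metric\<close>

text \<open>The product of the \<open>norm (w - a) powr (- b a)\<close> alone is flat, its logarithm
  being harmonic. For harmonic u the function \<open>ln (1 + exp u)\<close> has Laplacian
  \<open>exp u / (1 + exp u)\<^sup>2\<close> times the squared gradient of u. With
  \<open>u = 2 * \<epsilon> * ln (norm (w - a))\<close> the factors
  \<open>(1 + exp u) powr s\<close> therefore supply negative curvature and keep the exponents on
  \<open>A\<close>, but raise the growth at infinity by \<open>2 * \<epsilon> * s * card A\<close>.
  Prescribing that growth gives \<open>s_eq\<close>, and s > 0 says that the weights, with \<beta>
  for infinity, exceed 2: here \<gamma> > 2 enters. Weights strictly below 1 - 1/\<mu> make the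
  pullback vanish at ramified points, so a positive maximum in the Schwarz argument sits where the
  map is locally biholomorphic into the complement of \<open>A\<close>. The density tends to 0 at
  infinity, so the bound on the pullback controls the derivative only while g stays bounded. Hence a
  circle is estimated from a point where g is bounded, up to a first exit, and the limit infinity is
  the separate case in which no bounded values recur.\<close>

lemma ln_one_plus_exp_le:
  assumes "0 < x" "x \<le> y" "0 < (e::real)"
  shows "ln (1 + exp (e * ln x)) \<le> ln 2 + e * ln (1 + y)"
proof -
  have "1 + exp (e * ln x) \<le> 2 * exp (e * ln (1 + y))"
  proof -
    have "e * ln x \<le> e * ln (1 + y)" "0 \<le> e * ln (1 + y)"
      using assms by (auto intro!: mult_left_mono mult_nonneg_nonneg)
    then have "exp (e * ln x) \<le> exp (e * ln (1 + y))" "1 \<le> exp (e * ln (1 + y))"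
      by auto
    then show ?thesis by linarith
  qed
  then have "ln (1 + exp (e * ln x)) \<le> ln (2 * exp (e * ln (1 + y)))"
    by (subst ln_le_cancel_iff) (auto intro: add_pos_pos)
  then show ?thesis by (simp add: ln_mult)
qed

text \<open>The density \<open>\<rho>\<close> below has cone angles \<open>2 \<pi> (1 - b a)\<close> at \<open>a\<close> and
  \<open>2 \<pi> (1 - \<beta>)\<close> at infinity: by \<open>s_eq\<close> it grows like \<open>\<bar>w\<bar> powr (\<beta> - 2)\<close>.  The case \<open>\<beta> < 0\<close> is used if
  infinity is not among the ramified values; it makes the pullback vanish at simple poles too.\<close>

locale cone_metric =
  fixes A :: "complex set" and b :: "complex \<Rightarrow> real" and \<beta> \<epsilon> s :: real
  assumes fin: "finite A" and ne: "A \<noteq> {}"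
    and b_pos: "\<And>a. a \<in> A \<Longrightarrow> 0 < b a"
    and \<epsilon>_pos: "0 < \<epsilon>" and \<epsilon>_b: "\<And>a. a \<in> A \<Longrightarrow> \<epsilon> \<le> 1 - b a" and \<epsilon>_\<beta>: "\<epsilon> \<le> 1 - \<beta>"
    and s_pos: "0 < s" and s_eq: "2 * \<epsilon> * s * card A = (\<Sum>a\<in>A. b a) + \<beta> - 2"
begin

definition \<rho> :: "complex \<Rightarrow> real" where
  "\<rho> w = exp (\<Sum>a\<in>A. s * ln (1 + exp (2 * \<epsilon> * ln (norm (w - a)))) - b a * ln (norm (w - a)))"

text \<open>If \<open>a\<close> is nearest to w, at distance d, then all distances from w to
  \<open>A\<close> are at most a multiple of 1 + d, and those to points other than \<open>a\<close>
  are at least a multiple of it. One inequality thus covers the cone at \<open>a\<close> (small d)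
  and the end at infinity (large d).\<close>

lemma nearest_estimate:
  obtains K where "\<And>w a. w \<notin> A \<Longrightarrow> a \<in> A \<Longrightarrow> (\<And>x. x \<in> A \<Longrightarrow> norm (w - a) \<le> norm (w - x)) \<Longrightarrow>
    ln (\<rho> w) \<le> K + (b a - 2 + \<beta>) * ln (1 + norm (w - a)) - b a * ln (norm (w - a))"
proof -
  obtain D where D: "\<And>x. x \<in> A \<Longrightarrow> norm x \<le> D"
    using finite_imp_bounded[OF fin] by (auto simp: bounded_iff)
  have "D \<ge> 0" using D ne norm_ge_zero order_trans by blast
  define P where "P = (\<lambda>(x,y). norm (x - y)) ` {(x,y) \<in> A \<times> A. x \<noteq> y}"
  have "finite P" unfolding P_def using fin
    by (intro finite_imageI finite_subset[OF _ finite_cartesian_product[OF fin fin]]) auto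
  \<comment> \<open>The 1 keeps the minimum defined when \<open>A\<close> has a single point and
    \<open>P\<close> is empty.\<close>
  define \<delta> where "\<delta> = Min (insert 1 P)"
  have "\<delta> > 0" unfolding \<delta>_def using \<open>finite P\<close> by (auto simp: P_def)
  have \<delta>: "\<delta> \<le> norm (x - y)" if "x \<in> A" "y \<in> A" "x \<noteq> y" for x y
    unfolding \<delta>_def using \<open>finite P\<close> that by (intro Min_le) (force simp: P_def)+
  \<comment> \<open>For x other than the nearest point,
    \<open>1 + d \<le> (1 + 2/\<delta>) * norm (w - x)\<close>; \<open>Q\<close> is the logarithm of
    this constant.\<close>
  define Q where "Q = ln (1 + 2/\<delta>)"
  define B where "B = (\<Sum>a\<in>A. b a)"
  define K where "K = card A * s * (ln 2 + 2*\<epsilon>*ln (1 + 2 * D)) + B * Q"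
  have "Q \<ge> 0" unfolding Q_def using \<open>\<delta> > 0\<close> by simp
  show ?thesis
  proof (rule that[of K])
    fix w a assume w: "w \<notin> A" and a: "a \<in> A" and near: "\<And>x. x \<in> A \<Longrightarrow> norm (w - a) \<le> norm (w - x)"
    define d where "d = norm (w - a)"
    have "d > 0" using w a by (auto simp: d_def)
    have 1: "s * ln (1 + exp (2*\<epsilon>*ln (norm (w - x)))) \<le> s * (ln 2 + 2*\<epsilon>*(ln (1 + 2*D) + ln (1 + d)))"
      if x: "x \<in> A" for x
    proof -
      have "norm (w - x) \<le> norm (w - a) + norm a + norm x"
        using norm_triangle_ineq[of "w - a" a] norm_triangle_ineq4[of w x] by simp
      also have "\<dots> \<le> d + 2 * D" using D[OF x] D[OF a] by (simp add: d_def)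
      finally have "ln (1 + exp (2*\<epsilon>*ln (norm (w - x)))) \<le> ln 2 + 2*\<epsilon>*ln (1 + (d + 2*D))"
        using \<epsilon>_pos w x by (intro ln_one_plus_exp_le) auto
      also have "\<dots> \<le> ln 2 + 2*\<epsilon>*ln ((1 + 2*D) * (1 + d))"
        using \<epsilon>_pos \<open>d > 0\<close> \<open>D \<ge> 0\<close> by (intro add_left_mono mult_left_mono, subst ln_le_cancel_iff) (auto simp: algebra_simps intro: add_pos_nonneg)
      also have "ln ((1 + 2*D) * (1 + d)) = ln (1 + 2*D) + ln (1 + d)"
        using \<open>d > 0\<close> \<open>D \<ge> 0\<close> by (subst ln_mult) auto
      finally show ?thesis using s_pos by (intro mult_left_mono) auto
    qed
    have 2: "- (b x * ln (norm (w - x))) \<le> b x * (Q - ln (1 + d))" if x: "x \<in> A - {a}" for x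
    proof -
      define y where "y = norm (w - x)"
      have "d \<le> y" using near x by (auto simp: d_def y_def)
      have "\<delta> \<le> norm (x - a)" using \<delta> x a by auto
      also have "\<dots> \<le> y + d" unfolding y_def d_def
        using norm_triangle_ineq4[of "w - a" "w - x"] by simp
      finally have "1 \<le> 2/\<delta> * y" using \<open>d \<le> y\<close> \<open>\<delta> > 0\<close> by (simp add: field_simps)
      then have "1 + d \<le> (1 + 2/\<delta>) * y" using \<open>d \<le> y\<close> by (simp add: algebra_simps)
      then have "ln (1 + d) \<le> ln ((1 + 2/\<delta>) * y)" using \<open>d > 0\<close> by (subst ln_le_cancel_iff) auto
      also have "ln ((1 + 2/\<delta>) * y) = Q + ln y"
      proof -
        have "1 + 2/\<delta> > 0" "y > 0" using \<open>\<delta> > 0\<close> \<open>d > 0\<close> \<open>d \<le> y\<close> by (auto intro: add_pos_pos)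
        then show ?thesis unfolding Q_def by (simp add: ln_mult)
      qed
      finally have "- ln y \<le> Q - ln (1 + d)" by simp
      then show ?thesis using b_pos[of x] x mult_left_mono[of "- ln y" "Q - ln (1+d)" "b x"] by (simp add: y_def)
    qed
    have "(\<Sum>x\<in>A. s * ln (1 + exp (2*\<epsilon>*ln (norm (w - x)))))
        \<le> (\<Sum>x\<in>A. s * (ln 2 + 2*\<epsilon>*(ln (1 + 2*D) + ln (1 + d))))"
      by (intro sum_mono 1)
    also have "\<dots> = card A * s * (ln 2 + 2*\<epsilon>*ln (1 + 2 * D)) + (2 * \<epsilon> * s * card A) * ln (1 + d)"
      by (simp add: algebra_simps)
    \<comment> \<open>By \<open>s_eq\<close> the coefficient of \<open>ln (1 + d)\<close> becomes
      \<open>B + \<beta> - 2\<close>; in the sum with \<open>S2\<close> below, \<open>B\<close>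
      cancels and \<open>b a - 2 + \<beta>\<close> remains.\<close>
    finally have S1: "(\<Sum>x\<in>A. s * ln (1 + exp (2*\<epsilon>*ln (norm (w - x)))))
       \<le> card A * s * (ln 2 + 2*\<epsilon>*ln (1 + 2 * D)) + (B + \<beta> - 2) * ln (1 + d)"
      unfolding s_eq B_def .
    have "(\<Sum>x\<in>A. - (b x * ln (norm (w - x)))) = - (b a * ln d) + (\<Sum>x\<in>A - {a}. - (b x * ln (norm (w - x))))"
      using sum.remove[OF fin a, of "\<lambda>x. - (b x * ln (norm (w - x)))"] by (simp add: d_def)
    also have "\<dots> \<le> - (b a * ln d) + (\<Sum>x\<in>A - {a}. b x * (Q - ln (1 + d)))"
      by (intro add_left_mono sum_mono 2)
    also have "(\<Sum>x\<in>A - {a}. b x * (Q - ln (1 + d))) = (B - b a) * (Q - ln (1 + d))"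
      unfolding sum_distrib_right[symmetric] using sum.remove[OF fin a, of b] by (simp add: B_def)
    also have "\<dots> \<le> B * Q - (B - b a) * ln (1 + d)"
      using b_pos[OF a] \<open>Q \<ge> 0\<close> by (simp add: algebra_simps)
    finally have S2: "(\<Sum>x\<in>A. - (b x * ln (norm (w - x)))) \<le> - (b a * ln d) + (B * Q - (B - b a) * ln (1 + d))"
      by simp
    have "ln (\<rho> w) = (\<Sum>x\<in>A. s * ln (1 + exp (2*\<epsilon>*ln (norm (w - x))))) + (\<Sum>x\<in>A. - (b x * ln (norm (w - x))))"
      by (simp add: \<rho>_def sum.distrib[symmetric])
    also have "\<dots> \<le> K + (b a - 2 + \<beta>) * ln (1 + d) - b a * ln d"
      using S1 S2 unfolding K_def by (simp add: algebra_simps)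
    finally show "ln (\<rho> w) \<le> K + (b a - 2 + \<beta>) * ln (1 + norm (w - a)) - b a * ln (norm (w - a))"
      by (simp add: d_def)
  qed
qed

lemma obtain_nearest:
  obtains a where "a \<in> A" "\<And>x. x \<in> A \<Longrightarrow> norm (w - a) \<le> norm (w - x)"
proof -
  have "Min ((\<lambda>x. norm (w - x)) ` A) \<in> (\<lambda>x. norm (w - x)) ` A"
    using fin ne by (intro Min_in) auto
  then obtain a where "a \<in> A" "norm (w - a) = Min ((\<lambda>x. norm (w - x)) ` A)" by auto
  then show ?thesis using that[of a] fin by simp
qed

lemma \<rho>_pos: "0 < \<rho> w" by (simp add: \<rho>_def)

text \<open>\<open>4 s \<epsilon>\<^sup>2 \<tau> w a\<close> is the contribution of \<open>a\<close> to the Laplacian of \<open>ln \<rho>\<close> at \<open>w\<close>.\<close>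

definition \<tau> :: "complex \<Rightarrow> complex \<Rightarrow> real" where
  "\<tau> w a = exp (2*\<epsilon>*ln (norm (w - a))) / (1 + exp (2*\<epsilon>*ln (norm (w - a))))\<^sup>2 / (norm (w - a))\<^sup>2"

text \<open>The term of the nearest point suffices. For small d it has exponent
  \<open>2 * \<epsilon> - 2\<close> against \<open>- 2 * b a\<close> for the squared density, for
  large d \<open>- 2 * \<epsilon> - 2\<close> against \<open>2 * \<beta> - 4\<close>. The
  comparisons amount to \<open>\<epsilon> \<le> 1 - b a\<close> and
  \<open>\<epsilon> \<le> 1 - \<beta>\<close>; logarithms treat both ranges at once.\<close>

lemma curvature_bound:
  obtains c where "c > 0" "\<And>w. w \<notin> A \<Longrightarrow> c * (\<rho> w)\<^sup>2 \<le> (\<Sum>a\<in>A. \<tau> w a)"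
proof -
  obtain K where K: "\<And>w a. w \<notin> A \<Longrightarrow> a \<in> A \<Longrightarrow> (\<And>x. x \<in> A \<Longrightarrow> norm (w - a) \<le> norm (w - x)) \<Longrightarrow>
    ln (\<rho> w) \<le> K + (b a - 2 + \<beta>) * ln (1 + norm (w - a)) - b a * ln (norm (w - a))"
    using nearest_estimate by blast
  define K' where "K' = 2 * K + 2 * ln 2"
  show ?thesis
  proof (rule that[of "exp (- K')"])
    fix w assume w: "w \<notin> A"
    obtain a where a: "a \<in> A" and near: "\<And>x. x \<in> A \<Longrightarrow> norm (w - a) \<le> norm (w - x)"
      using obtain_nearest by blast
    define d where "d = norm (w - a)"
    have "d > 0" using w a by (auto simp: d_def)
    have \<tau>pos: "\<tau> w x > 0" if "x \<in> A" for x
      unfolding \<tau>_def using w that by (intro divide_pos_pos zero_less_power add_pos_pos) auto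
    have "ln (1 + exp (2*\<epsilon>*ln d)) \<le> ln 2 + 2*\<epsilon>*ln (1 + d)"
      using ln_one_plus_exp_le[of d d "2*\<epsilon>"] \<open>d > 0\<close> \<epsilon>_pos by simp
    moreover have "ln (\<tau> w a) = 2*\<epsilon>*ln d - 2 * ln (1 + exp (2*\<epsilon>*ln d)) - 2 * ln d"
    proof -
      have *: "ln (exp x / y\<^sup>2 / d\<^sup>2) = x - 2 * ln y - 2 * ln d" if "y > 0" for x y :: real
      proof -
        have "exp (x - 2 * ln y - 2 * ln d) = exp x / y\<^sup>2 / d\<^sup>2"
          unfolding exp_diff exp_of_nat_mult[of 2, simplified] using that \<open>d > 0\<close> by simp
        then show ?thesis by (metis ln_exp)
      qed
      show ?thesis
        unfolding \<tau>_def d_def[symmetric] by (rule *) (auto intro: add_pos_pos)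
    qed
    ultimately have T: "ln (\<tau> w a) \<ge> (2*\<epsilon>-2)*ln d - 2 * ln 2 - 4*\<epsilon>*ln (1 + d)"
      by (simp add: algebra_simps)
    have "2 * ln (\<rho> w) - ln (\<tau> w a) \<le> K' + (2*b a - 4 + 2*\<beta> + 4*\<epsilon>) * ln (1 + d) + 2*(1 - b a - \<epsilon>) * ln d"
      using K[OF w a near] T unfolding K'_def d_def[symmetric] by (simp add: algebra_simps)
    also have "2*(1 - b a - \<epsilon>) * ln d \<le> 2*(1 - b a - \<epsilon>) * ln (1 + d)"
      using \<epsilon>_b[OF a] \<open>d > 0\<close> by (intro mult_left_mono) auto
    also have "K' + (2*b a - 4 + 2*\<beta> + 4*\<epsilon>) * ln (1 + d) + \<dots> = K' - 2*(1 - \<beta> - \<epsilon>) * ln (1 + d)"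
      by (simp add: algebra_simps)
    also have "\<dots> \<le> K'"
      using \<epsilon>_\<beta> \<open>d > 0\<close> by (simp add: mult_nonneg_nonneg)
    finally have "2 * ln (\<rho> w) - K' \<le> ln (\<tau> w a)" by simp
    then have "exp (2 * ln (\<rho> w) - K') \<le> \<tau> w a"
      using \<tau>pos[OF a] by (simp add: ln_ge_iff)
    moreover have "exp (2 * ln (\<rho> w) - K') = exp (-K') * (\<rho> w)\<^sup>2"
      unfolding exp_diff exp_minus exp_of_nat_mult[of 2, simplified]
      using \<rho>_pos[of w] by (simp add: divide_inverse mult.commute)
    moreover have "\<tau> w a \<le> (\<Sum>a\<in>A. \<tau> w a)"
      using \<tau>pos fin a by (intro member_le_sum) (auto intro: less_imp_le)
    ultimately show "exp (-K') * (\<rho> w)\<^sup>2 \<le> (\<Sum>a\<in>A. \<tau> w a)" by simp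
  qed simp
qed

lemma \<rho>_le_near:
  assumes a: "a \<in> A"
  obtains C where "\<forall>\<^sub>F w in at a. \<rho> w \<le> C * norm (w - a) powr (- b a)"
proof -
  obtain K where K: "\<And>w a. w \<notin> A \<Longrightarrow> a \<in> A \<Longrightarrow> (\<And>x. x \<in> A \<Longrightarrow> norm (w - a) \<le> norm (w - x)) \<Longrightarrow>
    ln (\<rho> w) \<le> K + (b a - 2 + \<beta>) * ln (1 + norm (w - a)) - b a * ln (norm (w - a))"
    using nearest_estimate by blast
  obtain e where e: "e > 0" "\<And>x. x \<in> A \<Longrightarrow> x \<noteq> a \<Longrightarrow> e \<le> dist a x"
    using finite_set_avoid[OF fin, of a] by blast
  \<comment> \<open>Within \<open>e/2\<close> of \<open>a\<close> this point is the nearest one, and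
    within 1 the term \<open>ln (1 + d)\<close> is at most \<open>ln 2\<close>.\<close>
  have "\<rho> w \<le> exp (K + \<bar>b a - 2 + \<beta>\<bar> * ln 2) * norm (w - a) powr (- b a)"
    if w: "w \<noteq> a" "dist w a < min 1 (e/2)" for w
  proof -
    have near: "norm (w - a) \<le> norm (w - x)" if "x \<in> A" for x
      using e(2)[OF that] w dist_triangle[of a x w]
      by (cases "x = a") (auto simp: dist_norm norm_minus_commute)
    have "w \<notin> A" using near[of w] w by auto
    define d where "d = norm (w - a)"
    have d: "d > 0" "d < 1" using w by (auto simp: d_def dist_norm)
    have "(b a - 2 + \<beta>) * ln (1 + d) \<le> \<bar>b a - 2 + \<beta>\<bar> * ln 2"
      using d by (intro mult_mono) auto
    then have "ln (\<rho> w) \<le> K + \<bar>b a - 2 + \<beta>\<bar> * ln 2 - b a * ln d"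
      using K[OF \<open>w \<notin> A\<close> a near] by (simp add: d_def)
    then have "exp (ln (\<rho> w)) \<le> exp (K + \<bar>b a - 2 + \<beta>\<bar> * ln 2 - b a * ln d)" by simp
    then show ?thesis using d \<rho>_pos[of w] by (simp add: powr_def exp_diff exp_minus d_def field_simps)
  qed
  then show ?thesis using e(1)
    by (intro that[of "exp (K + \<bar>b a - 2 + \<beta>\<bar> * ln 2)"])
      (auto simp: eventually_at intro!: exI[of _ "min 1 (e/2)"])
qed

lemma \<rho>_le_at_infinity:
  obtains C where "\<forall>\<^sub>F w in at_infinity. w \<notin> A \<and> \<rho> w \<le> C * norm w powr (\<beta> - 2)"
proof -
  obtain K where K: "\<And>w a. w \<notin> A \<Longrightarrow> a \<in> A \<Longrightarrow> (\<And>x. x \<in> A \<Longrightarrow> norm (w - a) \<le> norm (w - x)) \<Longrightarrow>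
    ln (\<rho> w) \<le> K + (b a - 2 + \<beta>) * ln (1 + norm (w - a)) - b a * ln (norm (w - a))"
    using nearest_estimate by blast
  obtain D where D: "\<And>x. x \<in> A \<Longrightarrow> norm x \<le> D"
    using finite_imp_bounded[OF fin] by (auto simp: bounded_iff)
  have "D \<ge> 0" using D ne norm_ge_zero order_trans by blast
  have "w \<notin> A \<and> \<rho> w \<le> exp (K + ln 2 + (2 - \<beta>) * ln 2) * norm w powr (\<beta> - 2)"
    if w: "norm w \<ge> 2 * D + 2" for w
  proof -
    have "w \<notin> A" using D[of w] w \<open>D \<ge> 0\<close> by auto
    obtain a where a: "a \<in> A" and near: "\<And>x. x \<in> A \<Longrightarrow> norm (w - a) \<le> norm (w - x)"
      using obtain_nearest by blast
    define d where "d = norm (w - a)"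
    have d: "d \<ge> norm w / 2" "d \<ge> 1" using w D[OF a] norm_triangle_sub[of w a] \<open>D \<ge> 0\<close> by (auto simp: d_def)
    have "ln (1 + d) \<le> ln (2 * d)" using d by simp
    then have l1: "ln (1 + d) \<le> ln 2 + ln d" using d by (simp add: ln_mult)
    have l2: "0 \<le> ln (1 + d) - ln d" using d by simp
    have b1: "b a < 1" "0 < b a" using \<epsilon>_b[OF a] \<epsilon>_pos b_pos[OF a] by auto
    have "b a * (ln (1 + d) - ln d) \<le> 1 * ln 2"
      using l1 l2 b1 by (intro mult_mono) auto
    moreover have "(2 - \<beta>) * ln (norm w) - (2 - \<beta>) * ln 2 \<le> (2 - \<beta>) * ln (1 + d)"
    proof -
      have "ln (norm w / 2) \<le> ln (1 + d)" using d w \<open>D \<ge> 0\<close> by (subst ln_le_cancel_iff) auto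
      moreover have "ln (norm w / 2) = ln (norm w) - ln 2" using w \<open>D \<ge> 0\<close> by (subst ln_div) auto
      ultimately have "(2-\<beta>) * (ln (norm w) - ln 2) \<le> (2-\<beta>) * ln (1 + d)"
        using \<epsilon>_\<beta> \<epsilon>_pos by (intro mult_left_mono) auto
      then show ?thesis by (simp add: algebra_simps)
    qed
    ultimately have "ln (\<rho> w) \<le> K + ln 2 + (2 - \<beta>) * ln 2 + (\<beta> - 2) * ln (norm w)"
      using K[OF \<open>w \<notin> A\<close> a near] by (simp add: d_def algebra_simps)
    then have "exp (ln (\<rho> w)) \<le> exp (K + ln 2 + (2 - \<beta>) * ln 2 + (\<beta> - 2) * ln (norm w))"
      by (subst exp_le_cancel_iff)
    moreover have "w \<noteq> 0" using w \<open>D \<ge> 0\<close> by auto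
    ultimately have "\<rho> w \<le> exp (K + ln 2 + (2 - \<beta>) * ln 2) * norm w powr (\<beta> - 2)"
      using \<rho>_pos[of w] by (simp add: powr_def exp_add)
    then show ?thesis using \<open>w \<notin> A\<close> by blast
  qed
  then show ?thesis by (intro that) (auto simp: eventually_at_infinity)
qed

text \<open>Turns the bound on the pullback into one on the derivative of g where g is bounded. The
  restriction to bounded w matters, since the density tends to 0 at infinity.\<close>

lemma \<rho>_ge:
  obtains c where "c > 0" "\<And>w. norm w \<le> M \<Longrightarrow> w \<notin> A \<Longrightarrow> c \<le> \<rho> w"
proof (rule that[of "exp (\<Sum>a\<in>A. - (b a * ln (1 + \<bar>M\<bar> + norm a)))"])
  fix w assume w: "norm w \<le> M" "w \<notin> A"
  show "exp (\<Sum>a\<in>A. - (b a * ln (1 + \<bar>M\<bar> + norm a))) \<le> \<rho> w"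
    unfolding \<rho>_def exp_le_cancel_iff
  proof (rule sum_mono)
    fix a assume a: "a \<in> A"
    have "ln (norm (w - a)) \<le> ln (1 + \<bar>M\<bar> + norm a)"
      using w a norm_triangle_ineq4[of w a] by (subst ln_le_cancel_iff) (auto intro: add_pos_nonneg)
    then have "b a * ln (norm (w - a)) \<le> b a * ln (1 + \<bar>M\<bar> + norm a)"
      using b_pos[OF a] by simp
    moreover have "0 \<le> s * ln (1 + exp (2*\<epsilon>*ln (norm (w - a))))"
      using s_pos by (intro mult_nonneg_nonneg) auto
    ultimately show "- (b a * ln (1 + \<bar>M\<bar> + norm a))
        \<le> s * ln (1 + exp (2*\<epsilon>*ln (norm (w - a)))) - b a * ln (norm (w - a))" by simp
  qed
qed simp

end

section \<open>The Ahlfors--Schwarz lemma\<close>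

text \<open>At the maximum \<psi>' vanishes; if \<open>D\<close> were positive, \<psi>' would be
  positive just to the right of 0 and \<psi> would increase there.\<close>

lemma second_derivative_nonpos_at_max:
  fixes \<psi> \<psi>' :: "real \<Rightarrow> real"
  assumes 1: "\<forall>\<^sub>F t in nhds 0. (\<psi> has_real_derivative \<psi>' t) (at t)"
    and 2: "(\<psi>' has_real_derivative D) (at 0)"
    and max: "\<forall>\<^sub>F t in nhds 0. \<psi> t \<le> \<psi> 0"
  shows "D \<le> 0"
proof (rule ccontr)
  assume "\<not> D \<le> 0"
  from 1 max obtain d where d: "d > 0" "\<And>t. \<bar>t\<bar> < d \<Longrightarrow> (\<psi> has_real_derivative \<psi>' t) (at t)"
      "\<And>t. \<bar>t\<bar> < d \<Longrightarrow> \<psi> t \<le> \<psi> 0"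
    using eventually_conj[OF 1 max] unfolding eventually_nhds_metric by (auto simp: dist_real_def)
  have "\<psi>' 0 = 0"
    using DERIV_local_max[of \<psi> "\<psi>' 0" 0 d] d by auto
  with DERIV_pos_inc_right[OF 2] \<open>\<not> D \<le> 0\<close> obtain e where
    e: "e > 0" "\<And>h. 0 < h \<Longrightarrow> h < e \<Longrightarrow> 0 < \<psi>' h" by auto
  define t where "t = min d e / 2"
  have t: "0 < t" "t < d" "t < e" using d e by (auto simp: t_def)
  obtain x where "0 < x" "x < t" "\<psi> t - \<psi> 0 = (t - 0) * \<psi>' x"
    using MVT2[of 0 t \<psi> \<psi>'] t d(2) by auto
  moreover have "0 < t * \<psi>' x" using \<open>0 < x\<close> \<open>x < t\<close> e t by auto
  ultimately show False using d(3)[of t] t by auto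
qed

text \<open>Locally \<open>ln (norm h)\<close> is the real part of a logarithm of h, with derivative
  h'/h. Differentiating along a real line gives this without choosing a branch.\<close>

lemma has_real_derivative_ln_norm_line:
  assumes "(h has_field_derivative h') (at (z + of_real t * e))" "h (z + of_real t * e) \<noteq> 0"
  shows "((\<lambda>t. ln (norm (h (z + of_real t * e)))) has_real_derivative
           Re (h' / h (z + of_real t * e) * e)) (at t)"
proof -
  let ?w = "h (z + of_real t * e)"
  have "((\<lambda>t. z + of_real t * e) has_vector_derivative e) (at t)"
    by (auto intro!: derivative_eq_intros simp: has_vector_derivative_def scaleR_conv_of_real)
  from field_vector_diff_chain_at[OF this assms(1)]
  have "((\<lambda>t. h (z + of_real t * e)) has_vector_derivative (e * h')) (at t)"
    by (simp add: o_def)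
  then have "((\<lambda>t. h (z + of_real t * e)) has_derivative (\<lambda>x. x *\<^sub>R (e * h'))) (at t)"
    by (simp add: has_vector_derivative_def)
  then have "((\<lambda>t. norm (h (z + of_real t * e))) has_derivative (\<lambda>x. (x *\<^sub>R (e * h')) \<bullet> sgn ?w)) (at t)"
    using has_derivative_compose[where f = "\<lambda>t. h (z + of_real t * e)" and g = norm,
        OF _ has_derivative_norm[OF assms(2)]] by blast
  then have "((\<lambda>t. norm (h (z + of_real t * e))) has_derivative (*) ((e * h') \<bullet> sgn ?w)) (at t)"
    by (simp add: mult_commute_abs)
  then have "((\<lambda>t. norm (h (z + of_real t * e))) has_real_derivative (e * h') \<bullet> sgn ?w) (at t)"
    by (simp add: has_field_derivative_def)
  then have "((\<lambda>t. ln (norm (h (z + of_real t * e)))) has_real_derivative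
      1 / norm ?w * ((e * h') \<bullet> sgn ?w)) (at t)"
    using DERIV_chain2[where f = ln and g = "\<lambda>t. norm (h (z + of_real t * e))",
        OF DERIV_ln_divide[of "norm ?w"]] assms(2) by simp
  moreover have inner_sgn: "1 / norm w * (v \<bullet> sgn w) = Re (v / w)" for v w :: complex
  proof -
    have "v \<bullet> sgn w = (v \<bullet> w) / norm w"
      unfolding sgn_div_norm inner_scaleR_right by (simp add: divide_inverse)
    then have "1 / norm w * (v \<bullet> sgn w) = (v \<bullet> w) / (norm w)\<^sup>2"
      by (simp add: power2_eq_square)
    then show ?thesis
      unfolding cmod_power2 by (simp add: inner_complex_def Re_divide add_divide_distrib)
  qed
  ultimately show ?thesis using inner_sgn[of ?w "e * h'"] by (simp add: mult.commute)
qed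

lemma has_real_derivative_Re_line:
  assumes "(q has_field_derivative q') (at (z + of_real t * e))"
  shows "((\<lambda>t. Re (q (z + of_real t * e) * e)) has_real_derivative Re (q' * e\<^sup>2)) (at t)"
proof -
  have "((\<lambda>t. z + of_real t * e) has_vector_derivative e) (at t)"
    by (auto intro!: derivative_eq_intros simp: has_vector_derivative_def scaleR_conv_of_real)
  from field_vector_diff_chain_at[OF this assms(1)]
  have "((\<lambda>t. q (z + of_real t * e)) has_vector_derivative (e * q')) (at t)"
    by (simp add: o_def)
  then have "((\<lambda>t. q (z + of_real t * e) * e) has_vector_derivative (e * q' * e)) (at t)"
    by (rule has_vector_derivative_mult_left)
  then have "((\<lambda>t. Re (q (z + of_real t * e) * e)) has_vector_derivative (Re (e * q' * e))) (at t)"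
    by (rule bounded_linear.has_vector_derivative[OF bounded_linear_Re])
  then show ?thesis
    by (simp add: has_real_derivative_iff_has_vector_derivative power2_eq_square mult_ac)
qed

lemma eventually_nhds_line:
  fixes z e :: complex
  assumes "\<forall>\<^sub>F w in nhds z. P w"
  shows "\<forall>\<^sub>F t in nhds (0::real). P (z + of_real t * e)"
proof -
  have "((\<lambda>t. z + of_real t * e) \<longlongrightarrow> z + of_real 0 * e) (nhds (0::real))"
    by (intro tendsto_intros filterlim_ident)
  then show ?thesis using assms by (simp add: filterlim_iff)
qed

section \<open>The second-order test at a maximum and the Schwarz bound\<close>

context cone_metric begin

text \<open>The left side is the second derivative, along the line through \<open>z0\<close> in
  direction e, of the logarithm of the maximised product. \<open>Q\<close> and \<open>q a\<close>
  are the logarithmic derivatives of \<open>deriv F\<close> and \<open>F - a\<close>; the first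
  summand comes from \<open>ln (R\<^sup>2 - (norm (z - c))\<^sup>2)\<close>.\<close>

lemma directional_laplace_test:
  fixes R :: real and c z0 e :: complex and F :: "complex \<Rightarrow> complex"
  defines "P \<equiv> R\<^sup>2 - (norm (z0 - c))\<^sup>2"
    and "Q \<equiv> \<lambda>w. deriv (deriv F) w / deriv F w" and "q \<equiv> \<lambda>a w. deriv F w / (F w - a)"
    and "x \<equiv> \<lambda>a. 2 * \<epsilon> * ln (norm (F z0 - a))"
  assumes V: "open V" "z0 \<in> V" and F: "F holomorphic_on V"
    and FA: "\<And>w. w \<in> V \<Longrightarrow> F w \<notin> A" and F': "\<And>w. w \<in> V \<Longrightarrow> deriv F w \<noteq> 0"
    and R: "0 < P" and e: "norm e = 1"
    and max: "\<forall>\<^sub>F z in nhds z0. (R\<^sup>2 - (norm (z - c))\<^sup>2) * (\<rho> (F z) * norm (deriv F z)) \<le> P * (\<rho> (F z0) * norm (deriv F z0))"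
  shows "(- 2 * P - 4 * (Re e * Re (z0 - c) + Im e * Im (z0 - c))\<^sup>2) / P\<^sup>2 + Re (deriv Q z0 * e\<^sup>2)
    + (\<Sum>a\<in>A. s * (exp (x a) / (1 + exp (x a))\<^sup>2 * (2 * \<epsilon> * Re (q a z0 * e))\<^sup>2
           + exp (x a) / (1 + exp (x a)) * (2 * \<epsilon> * Re (deriv (q a) z0 * e\<^sup>2)))
        - b a * Re (deriv (q a) z0 * e\<^sup>2)) \<le> 0"
proof -
  define l where "l t = z0 + of_real t * e" for t
  define N where "N t = R\<^sup>2 - (norm (l t - c))\<^sup>2" for t
  define N' where "N' t = - 2 * (Re e * Re (l t - c) + Im e * Im (l t - c))" for t
  define X where "X a t = 2 * \<epsilon> * ln (norm (F (l t) - a))" for a t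
  define \<psi> where "\<psi> t = ln (N t) + ln (norm (deriv F (l t)))
    + (\<Sum>a\<in>A. s * ln (1 + exp (X a t)) - b a * ln (norm (F (l t) - a)))" for t
  define \<psi>' where "\<psi>' t = N' t / N t + Re (Q (l t) * e)
    + (\<Sum>a\<in>A. s * (exp (X a t) / (1 + exp (X a t)) * (2 * \<epsilon> * Re (q a (l t) * e))) - b a * Re (q a (l t) * e))" for t
  have exppos: "0 < 1 + exp y" for y :: real by (intro add_pos_pos) auto
  have exppos': "1 + exp y \<noteq> 0" for y :: real using exppos[of y] by simp
  have l0: "l 0 = z0" by (simp add: l_def)
  have N0: "N 0 = P" by (simp add: N_def l0 P_def)
  have N: "N = (\<lambda>t. R\<^sup>2 - ((Re z0 + t * Re e - Re c)\<^sup>2 + (Im z0 + t * Im e - Im c)\<^sup>2))"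
    by (simp add: N_def cmod_power2 l_def fun_eq_iff)
  have N': "N' = (\<lambda>t. - 2 * (Re e * (Re z0 + t * Re e - Re c) + Im e * (Im z0 + t * Im e - Im c)))"
    by (simp add: N'_def l_def fun_eq_iff)
  have dN: "(N has_real_derivative N' t) (at t)" for t
    unfolding N N' by (rule derivative_eq_intros refl | simp add: algebra_simps)+
  have e2: "Re e * Re e + Im e * Im e = 1"
    using e cmod_power2[of e] by (simp add: power2_eq_square)
  have dN': "(N' has_real_derivative - 2) (at t)" for t
  proof -
    have "(N' has_real_derivative - 2 * (Re e * Re e + Im e * Im e)) (at t)"
      unfolding N' by (rule derivative_eq_intros refl | simp)+
    then show ?thesis by (simp add: e2)
  qed
  have holF': "deriv F holomorphic_on V" using F V(1) by (rule holomorphic_deriv)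
  have holQ: "Q holomorphic_on V" unfolding Q_def
    using F' by (intro holomorphic_on_divide holF' holomorphic_deriv[OF holF' V(1)])
  have holq: "q a holomorphic_on V" if "a \<in> A" for a unfolding q_def
    using FA that by (intro holomorphic_on_divide holF' holomorphic_on_diff F holomorphic_on_const) auto
  have evV: "\<forall>\<^sub>F t in nhds 0. l t \<in> V"
    unfolding l_def by (intro eventually_nhds_line eventually_nhds_in_open V)
  have evN: "\<forall>\<^sub>F t in nhds 0. 0 < N t"
  proof -
    have "isCont N 0" using dN DERIV_isCont by blast
    then have "(N \<longlongrightarrow> N 0) (nhds 0)" by (simp add: tendsto_nhds_iff isCont_def)
    then show ?thesis using R N0 order_tendstoD(1) by metis
  qed
  have dX: "(X a has_real_derivative 2 * \<epsilon> * Re (q a (l t) * e)) (at t)" if "l t \<in> V" "a \<in> A" for a t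
  proof -
    have "((\<lambda>w. F w - a) has_field_derivative deriv F (l t)) (at (l t))"
      using holomorphic_derivI[OF F V(1) that(1)] by (auto intro!: derivative_eq_intros)
    then have "((\<lambda>t. ln (norm (F (l t) - a))) has_real_derivative Re (q a (l t) * e)) (at t)"
      unfolding q_def l_def
      by (rule has_real_derivative_ln_norm_line) (use that FA in \<open>auto simp: l_def\<close>)
    then show ?thesis unfolding X_def by (rule DERIV_cmult)
  qed
  have 1: "\<forall>\<^sub>F t in nhds 0. (\<psi> has_real_derivative \<psi>' t) (at t)"
    using evV evN
  proof eventually_elim
    fix t assume t: "l t \<in> V" "0 < N t"
    have *: "((\<lambda>t. ln (norm (F (l t) - a))) has_real_derivative Re (q a (l t) * e)) (at t)" if "a \<in> A" for a
      using DERIV_cmult[OF dX[OF t(1) that], of "1/(2*\<epsilon>)"] \<epsilon>_pos by (simp add: X_def)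
    have "((\<lambda>t. ln (norm (deriv F (l t)))) has_real_derivative Re (Q (l t) * e)) (at t)"
      unfolding Q_def l_def using t F' holomorphic_derivI[OF holF' V(1) t(1)]
      by (intro has_real_derivative_ln_norm_line) (auto simp: l_def)
    moreover have "((\<lambda>t. ln (N t)) has_real_derivative N' t / N t) (at t)"
      using dN[of t] t by (auto intro!: derivative_eq_intros simp: field_simps)
    moreover have "((\<lambda>t. s * ln (1 + exp (X a t)) - b a * ln (norm (F (l t) - a))) has_real_derivative
        s * (exp (X a t) / (1 + exp (X a t)) * (2 * \<epsilon> * Re (q a (l t) * e))) - b a * Re (q a (l t) * e)) (at t)" if "a \<in> A" for a
    proof -
      have "((\<lambda>t. ln (1 + exp (X a t))) has_real_derivative
          exp (X a t) / (1 + exp (X a t)) * (2 * \<epsilon> * Re (q a (l t) * e))) (at t)"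
        by (rule derivative_eq_intros dX[OF t(1) that] exppos refl | simp)+
      then show ?thesis by (intro DERIV_diff DERIV_cmult *[OF that])
    qed
    ultimately show "(\<psi> has_real_derivative \<psi>' t) (at t)"
      unfolding \<psi>_def \<psi>'_def by (intro DERIV_add DERIV_sum)
  qed
  have x: "X a 0 = x a" for a by (simp add: X_def x_def l0)
  have 2: "(\<psi>' has_real_derivative
      (- 2 * P - 4 * (Re e * Re (z0 - c) + Im e * Im (z0 - c))\<^sup>2) / P\<^sup>2 + Re (deriv Q z0 * e\<^sup>2)
    + (\<Sum>a\<in>A. s * (exp (x a) / (1 + exp (x a))\<^sup>2 * (2 * \<epsilon> * Re (q a z0 * e))\<^sup>2
           + exp (x a) / (1 + exp (x a)) * (2 * \<epsilon> * Re (deriv (q a) z0 * e\<^sup>2)))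
        - b a * Re (deriv (q a) z0 * e\<^sup>2))) (at 0)"
  proof -
    have "((\<lambda>t. N' t / N t) has_real_derivative (- 2 * N 0 - N' 0 * N' 0) / (N 0 * N 0)) (at 0)"
      using R N0 by (intro DERIV_divide dN dN') auto
    moreover have "((\<lambda>t. N' t / N t) has_real_derivative
        (- 2 * P - 4 * (Re e * Re (z0 - c) + Im e * Im (z0 - c))\<^sup>2) / P\<^sup>2) (at 0)"
      if "((\<lambda>t. N' t / N t) has_real_derivative (- 2 * N 0 - N' 0 * N' 0) / (N 0 * N 0)) (at 0)"
    proof -
      define u where "u = Re e * Re (z0 - c) + Im e * Im (z0 - c)"
      have "N' 0 * N' 0 = 4 * u\<^sup>2"
        unfolding N'_def l0 u_def[symmetric] power2_eq_square by simp
      then show ?thesis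
        using that unfolding u_def[symmetric] by (simp add: N0 power2_eq_square)
    qed
    moreover have "((\<lambda>t. Re (Q (l t) * e)) has_real_derivative Re (deriv Q z0 * e\<^sup>2)) (at 0)"
      unfolding l_def using holomorphic_derivI[OF holQ V] by (intro has_real_derivative_Re_line) auto
    moreover have "((\<lambda>t. s * (exp (X a t) / (1 + exp (X a t)) * (2 * \<epsilon> * Re (q a (l t) * e))) - b a * Re (q a (l t) * e))
      has_real_derivative s * (exp (x a) / (1 + exp (x a))\<^sup>2 * (2 * \<epsilon> * Re (q a z0 * e))\<^sup>2
           + exp (x a) / (1 + exp (x a)) * (2 * \<epsilon> * Re (deriv (q a) z0 * e\<^sup>2)))
        - b a * Re (deriv (q a) z0 * e\<^sup>2)) (at 0)" if a: "a \<in> A" for a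
    proof -
      have q: "((\<lambda>t. Re (q a (l t) * e)) has_real_derivative Re (deriv (q a) z0 * e\<^sup>2)) (at 0)"
        unfolding l_def using holomorphic_derivI[OF holq[OF a] V] by (intro has_real_derivative_Re_line) auto
      have X: "(X a has_real_derivative 2 * \<epsilon> * Re (q a z0 * e)) (at 0)"
        using dX[of 0 a] a V by (simp add: l0)
      have "((\<lambda>t. exp (X a t) / (1 + exp (X a t))) has_real_derivative
          exp (x a) / (1 + exp (x a))\<^sup>2 * (2 * \<epsilon> * Re (q a z0 * e))) (at 0)"
        using exppos' by (auto intro!: derivative_eq_intros X simp: x divide_simps power2_eq_square) (simp add: algebra_simps)
      from DERIV_diff[OF DERIV_cmult[OF DERIV_mult[OF this DERIV_cmult[OF q, of "2*\<epsilon>"]], of s] DERIV_cmult[OF q, of "b a"]]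
      show ?thesis unfolding x l0 by (rule DERIV_cong) (simp only: power2_eq_square mult_ac)
    qed
    ultimately show ?thesis unfolding \<psi>'_def by (intro DERIV_add DERIV_sum)
  qed
  have "\<forall>\<^sub>F t in nhds 0. N t * (\<rho> (F (l t)) * norm (deriv F (l t))) \<le> P * (\<rho> (F z0) * norm (deriv F z0))"
    using eventually_nhds_line[OF max, of e] unfolding N_def l_def by simp
  then have 3: "\<forall>\<^sub>F t in nhds 0. \<psi> t \<le> \<psi> 0"
    using evV evN
  proof eventually_elim
    fix t assume t: "N t * (\<rho> (F (l t)) * norm (deriv F (l t))) \<le> P * (\<rho> (F z0) * norm (deriv F z0))"
      "l t \<in> V" "0 < N t"
    have ln\<psi>: "\<psi> t = ln (N t * (\<rho> (F (l t)) * norm (deriv F (l t))))" if "l t \<in> V" "0 < N t" for t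
      unfolding \<psi>_def using that F'[of "l t"] \<rho>_pos[of "F (l t)"] by (simp add: ln_mult \<rho>_def X_def)
    show "\<psi> t \<le> \<psi> 0"
      using t ln\<psi>[of t] ln\<psi>[of 0] V R F'[of z0] F'[of "l t"] \<rho>_pos[of "F (l t)"] \<rho>_pos[of "F z0"]
      by (simp add: l0 N0)
  qed
  show ?thesis using second_derivative_nonpos_at_max[OF 1 2 3] .
qed

text \<open>Summing the second derivatives in the directions 1 and \<open>\<i>\<close> removes the harmonic terms.\<close>

lemma laplace_test:
  fixes R :: real and c z0 :: complex and F :: "complex \<Rightarrow> complex"
  defines "P \<equiv> R\<^sup>2 - (norm (z0 - c))\<^sup>2"
  assumes V: "open V" "z0 \<in> V" and F: "F holomorphic_on V"
    and FA: "\<And>w. w \<in> V \<Longrightarrow> F w \<notin> A" and F': "\<And>w. w \<in> V \<Longrightarrow> deriv F w \<noteq> 0"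
    and R: "0 < P"
    and max: "\<forall>\<^sub>F z in nhds z0. (R\<^sup>2 - (norm (z - c))\<^sup>2) * (\<rho> (F z) * norm (deriv F z)) \<le> P * (\<rho> (F z0) * norm (deriv F z0))"
  shows "s * \<epsilon>\<^sup>2 * (\<Sum>a\<in>A. \<tau> (F z0) a) * (norm (deriv F z0))\<^sup>2 * P\<^sup>2 \<le> R\<^sup>2"
proof -
  define Q where "Q w = deriv (deriv F) w / deriv F w" for w
  define q where "q a w = deriv F w / (F w - a)" for a w
  define x where "x a = 2 * \<epsilon> * ln (norm (F z0 - a))" for a
  define G where "G e = (\<Sum>a\<in>A. s * (exp (x a) / (1 + exp (x a))\<^sup>2 * (2 * \<epsilon> * Re (q a z0 * e))\<^sup>2
           + exp (x a) / (1 + exp (x a)) * (2 * \<epsilon> * Re (deriv (q a) z0 * e\<^sup>2)))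
        - b a * Re (deriv (q a) z0 * e\<^sup>2))" for e
  have *: "(- 2 * P - 4 * (Re e * Re (z0 - c) + Im e * Im (z0 - c))\<^sup>2) / P\<^sup>2 + Re (deriv Q z0 * e\<^sup>2) + G e \<le> 0"
    if "norm e = 1" for e
    using directional_laplace_test[OF V F FA F' _ that, of R c] R max
    unfolding P_def Q_def[abs_def] q_def[abs_def] x_def G_def by simp
  \<comment> \<open>Since \<i> squares to -1, the terms in v cancel, while the squares of the real
    parts of u and \<open>u * \<i>\<close> add up to \<open>(norm u)\<^sup>2\<close>.\<close>
  have two: "s * (K * (2 * \<epsilon> * Re (u * 1))\<^sup>2 + M * (2 * \<epsilon> * Re (v * 1\<^sup>2))) - B * Re (v * 1\<^sup>2)
      + (s * (K * (2 * \<epsilon> * Re (u * \<i>))\<^sup>2 + M * (2 * \<epsilon> * Re (v * \<i>\<^sup>2))) - B * Re (v * \<i>\<^sup>2))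
      = 4 * s * \<epsilon>\<^sup>2 * (K * (norm u)\<^sup>2)" for K M B u v
    unfolding cmod_power2 by simp algebra
  have "G 1 + G \<i> = (\<Sum>a\<in>A. 4 * s * \<epsilon>\<^sup>2 * (exp (x a) / (1 + exp (x a))\<^sup>2 * (norm (q a z0))\<^sup>2))"
    unfolding G_def sum.distrib[symmetric] two ..
  also have "\<dots> = 4 * s * \<epsilon>\<^sup>2 * (\<Sum>a\<in>A. \<tau> (F z0) a) * (norm (deriv F z0))\<^sup>2"
    unfolding sum_distrib_left[symmetric] mult.assoc sum_distrib_right
    by (simp add: \<tau>_def q_def x_def norm_divide power_divide)
  finally have G: "G 1 + G \<i> = 4 * s * \<epsilon>\<^sup>2 * (\<Sum>a\<in>A. \<tau> (F z0) a) * (norm (deriv F z0))\<^sup>2" .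
  have "(- 2 * P - 4 * (Re (z0 - c))\<^sup>2) / P\<^sup>2 + (- 2 * P - 4 * (Im (z0 - c))\<^sup>2) / P\<^sup>2 + (G 1 + G \<i>) \<le> 0"
    using *[of 1] *[of \<i>] by simp
  \<comment> \<open>The numerators add up to \<open>- 4 * P - 4 * (norm (z0 - c))\<^sup>2\<close>,
    which is \<open>- 4 * R\<^sup>2\<close>; the quotient is the Laplacian of the logarithm of
    \<open>R\<^sup>2 - (norm (z - c))\<^sup>2\<close> at \<open>z0\<close>.\<close>
  moreover have "(- 2 * P - 4 * (Re (z0 - c))\<^sup>2) / P\<^sup>2 + (- 2 * P - 4 * (Im (z0 - c))\<^sup>2) / P\<^sup>2
     = - 4 * R\<^sup>2 / P\<^sup>2"
    unfolding add_divide_distrib[symmetric] by (simp add: P_def cmod_power2)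
  ultimately have "(G 1 + G \<i>) \<le> 4 * R\<^sup>2 / P\<^sup>2" by simp
  then have "(G 1 + G \<i>) * P\<^sup>2 \<le> 4 * R\<^sup>2" using R by (simp add: field_simps)
  then show ?thesis unfolding G by (simp add: mult_ac)
qed

text \<open>The function \<open>(R\<^sup>2 - (norm (z - c))\<^sup>2) * U z\<close> vanishes on the
  circle of radius R < r, so a positive value at the centre forces an interior maximum with U > 0.
  There \<open>laplace_test\<close> and \<open>curvature_bound\<close> bound it by a multiple of R;
  then R tends to r. The hypothesis on U is local and restricted to U > 0 because a pullback has
  zeros, and near different points different maps F may represent it.\<close>

proposition ahlfors_schwarz:
  obtains C where "\<And>c r U. 0 < r \<Longrightarrow> continuous_on (ball c r) U \<Longrightarrow> (\<And>z. z \<in> ball c r \<Longrightarrow> 0 \<le> U z) \<Longrightarrow>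
    (\<And>z. z \<in> ball c r \<Longrightarrow> U z > 0 \<Longrightarrow> \<exists>V F. open V \<and> z \<in> V \<and> F holomorphic_on V \<and>
        (\<forall>w\<in>V. F w \<notin> A \<and> deriv F w \<noteq> 0 \<and> U w = \<rho> (F w) * norm (deriv F w))) \<Longrightarrow>
    U c \<le> C / r"
proof -
  obtain k where k: "k > 0" "\<And>w. w \<notin> A \<Longrightarrow> k * (\<rho> w)\<^sup>2 \<le> (\<Sum>a\<in>A. \<tau> w a)"
    using curvature_bound by blast
  define \<kappa> where "\<kappa> = s * \<epsilon>\<^sup>2 * k"
  have pos: "\<kappa> > 0" using s_pos \<epsilon>_pos k by (simp add: \<kappa>_def)
  define C where "C = 1 / sqrt \<kappa>"
  have "C > 0" and C2: "C\<^sup>2 * \<kappa> = 1" using pos by (simp_all add: C_def power_divide)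
  show ?thesis
  proof (rule that[of C])
    fix c :: complex and r U
    assume r: "0 < (r::real)" and contU: "continuous_on (ball c r) U"
      and U0: "\<And>z. z \<in> ball c r \<Longrightarrow> 0 \<le> U z"
      and loc: "\<And>z. z \<in> ball c r \<Longrightarrow> U z > 0 \<Longrightarrow> \<exists>V F. open V \<and> z \<in> V \<and> F holomorphic_on V \<and>
        (\<forall>w\<in>V. F w \<notin> A \<and> deriv F w \<noteq> 0 \<and> U w = \<rho> (F w) * norm (deriv F w))"
    have R_le: "U c \<le> C / R" if R: "0 < R" "R < r" for R
    proof (cases "U c = 0")
      case True then show ?thesis using \<open>C > 0\<close> R by simp
    next
      case False
      then have "U c > 0" using U0[of c] r by simp
      define \<Phi> where "\<Phi> z = (R\<^sup>2 - (norm (z - c))\<^sup>2) * U z" for z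
      have sub: "cball c R \<subseteq> ball c r" using R by auto
      have "continuous_on (cball c R) \<Phi>" unfolding \<Phi>_def
        by (intro continuous_intros continuous_on_subset[OF contU sub])
      from continuous_attains_sup[OF compact_cball _ this] R obtain z0 where
        z0: "z0 \<in> cball c R" and zmax: "\<And>z. z \<in> cball c R \<Longrightarrow> \<Phi> z \<le> \<Phi> z0"
        by auto
      have "\<Phi> c > 0" using \<open>U c > 0\<close> R by (simp add: \<Phi>_def)
      then have "\<Phi> z0 > 0" using zmax[of c] R by simp
      then have Pz: "R\<^sup>2 - (norm (z0 - c))\<^sup>2 > 0" and Uz: "U z0 > 0"
        using U0[of z0] z0 sub R unfolding \<Phi>_def by (auto simp: zero_less_mult_iff)
      have z0': "z0 \<in> ball c R" using Pz R power2_less_imp_less[of "norm (z0 - c)" R]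
        by (simp add: dist_norm norm_minus_commute)
      obtain V F where V: "open V" "z0 \<in> V" and F: "F holomorphic_on V"
        and VF: "\<And>w. w \<in> V \<Longrightarrow> F w \<notin> A" "\<And>w. w \<in> V \<Longrightarrow> deriv F w \<noteq> 0"
          "\<And>w. w \<in> V \<Longrightarrow> U w = \<rho> (F w) * norm (deriv F w)"
        using loc[of z0] z0 sub Uz by (metis subset_iff)
      have "\<forall>\<^sub>F z in nhds z0. z \<in> V \<inter> ball c R" using V z0' by (intro eventually_nhds_in_open) auto
      then have "\<forall>\<^sub>F z in nhds z0. (R\<^sup>2 - (norm (z - c))\<^sup>2) * (\<rho> (F z) * norm (deriv F z))
          \<le> (R\<^sup>2 - (norm (z0 - c))\<^sup>2) * (\<rho> (F z0) * norm (deriv F z0))"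
      proof eventually_elim
        case (elim z)
        then show ?case using zmax[of z] VF(3)[of z] VF(3)[OF V(2)] by (simp add: \<Phi>_def)
      qed
      from laplace_test[OF V F VF(1,2) Pz this]
      have "s * \<epsilon>\<^sup>2 * (\<Sum>a\<in>A. \<tau> (F z0) a) * ((norm (deriv F z0))\<^sup>2 * (R\<^sup>2 - (norm (z0 - c))\<^sup>2)\<^sup>2) \<le> R\<^sup>2"
        by (simp add: mult.assoc)
      moreover have "s * \<epsilon>\<^sup>2 * (k * (\<rho> (F z0))\<^sup>2) * ((norm (deriv F z0))\<^sup>2 * (R\<^sup>2 - (norm (z0 - c))\<^sup>2)\<^sup>2)
          \<le> s * \<epsilon>\<^sup>2 * (\<Sum>a\<in>A. \<tau> (F z0) a) * ((norm (deriv F z0))\<^sup>2 * (R\<^sup>2 - (norm (z0 - c))\<^sup>2)\<^sup>2)"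
        using k VF V s_pos by (intro mult_right_mono mult_left_mono) auto
      ultimately have "\<kappa> * (\<Phi> z0)\<^sup>2 \<le> R\<^sup>2"
        using VF(3)[OF V(2)] by (simp add: \<Phi>_def \<kappa>_def power_mult_distrib mult_ac)
      then have "C\<^sup>2 * (\<kappa> * (\<Phi> z0)\<^sup>2) \<le> C\<^sup>2 * R\<^sup>2" by (intro mult_left_mono) auto
      then have "(\<Phi> z0)\<^sup>2 \<le> (C * R)\<^sup>2"
        unfolding mult.assoc[symmetric] C2 by (simp add: power_mult_distrib)
      then have "\<Phi> z0 \<le> C * R" 
        by (rule power2_le_imp_le) (intro mult_nonneg_nonneg less_imp_le \<open>C > 0\<close> R)
      then have "R\<^sup>2 * U c \<le> C * R" using zmax[of c] R by (simp add: \<Phi>_def)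
      then show ?thesis using R by (simp add: power2_eq_square field_simps)
    qed
    have "((\<lambda>R. C / R) \<longlongrightarrow> C / r) (at_left r)"
      using r by (intro tendsto_divide tendsto_const tendsto_ident_at) auto
    moreover have "\<forall>\<^sub>F R in at_left r. U c \<le> C / R"
      using eventually_at_left_real[OF r] by eventually_elim (use R_le in auto)
    ultimately show "U c \<le> C / r"
      by (rule tendsto_lowerbound) auto
  qed
qed

end

section \<open>Pulling back the metric to the punctured disc\<close>

lemma holomorphic_on_locally:
  assumes "\<And>z. z \<in> X \<Longrightarrow> \<exists>W. open W \<and> z \<in> W \<and> W \<subseteq> X \<and> h holomorphic_on W"
  shows "open X" "h holomorphic_on X"
proof -
  show "open X" using assms by (subst open_subopen) blast
  show "h holomorphic_on X"
    unfolding holomorphic_on_def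
  proof
    fix z assume "z \<in> X"
    then obtain W where "open W" "z \<in> W" "W \<subseteq> X" "h holomorphic_on W" using assms by blast
    then show "h field_differentiable at z within X"
      using holomorphic_on_imp_differentiable_at field_differentiable_at_within by blast
  qed
qed

text \<open>Unconditional thanks to \<open>inverse 0 = 0\<close>, which agrees with the dummy values
  of both charts.\<close>

lemma infty_chart_eq: "infty_chart x = inverse (affine_chart x)"
  by (cases x) auto

text \<open>Where only the chart at infinity is known to be holomorphic, its inverse gives the
  affine chart after shrinking to the set where it does not vanish. This trades the local choice of
  charts for one fixed function on an open set.\<close>

lemma sphere_holomorphic_affine:
  assumes "sphere_holomorphic_on g S"
  shows "open {z \<in> S. g z \<noteq> Infty}" "(\<lambda>z. affine_chart (g z)) holomorphic_on {z \<in> S. g z \<noteq> Infty}"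
proof -
  have "\<exists>W. open W \<and> z \<in> W \<and> W \<subseteq> {z \<in> S. g z \<noteq> Infty} \<and> (\<lambda>z. affine_chart (g z)) holomorphic_on W"
    if z: "z \<in> {z \<in> S. g z \<noteq> Infty}" for z
  proof -
    obtain U where U: "open U" "z \<in> U" "U \<subseteq> S" and
      c: "(Infty \<notin> g ` U \<and> (\<lambda>w. affine_chart (g w)) holomorphic_on U) \<or>
         (Cplx 0 \<notin> g ` U \<and> (\<lambda>w. infty_chart (g w)) holomorphic_on U)"
      using assms z unfolding sphere_holomorphic_on_def by blast
    from c show ?thesis
    proof
      assume "Infty \<notin> g ` U \<and> (\<lambda>w. affine_chart (g w)) holomorphic_on U"
      then show ?thesis using U by (intro exI[of _ U]) force
    next
      assume *: "Cplx 0 \<notin> g ` U \<and> (\<lambda>w. infty_chart (g w)) holomorphic_on U"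
      define W where "W = {w \<in> U. infty_chart (g w) \<noteq> 0}"
      have "W = U \<inter> (\<lambda>w. infty_chart (g w)) -` (- {0})" by (auto simp: W_def)
      then have "open W"
        using * U by (metis continuous_open_preimage holomorphic_on_imp_continuous_on open_Compl closed_singleton)
      have "z \<in> W" using z U * by (cases "g z") (auto simp: W_def image_iff)
      have "(\<lambda>w. inverse (infty_chart (g w))) holomorphic_on W"
        using * by (intro holomorphic_on_inverse holomorphic_on_subset[of _ U W]) (auto simp: W_def)
      moreover have "W \<subseteq> {z \<in> S. g z \<noteq> Infty}" using U by (auto simp: W_def)
      ultimately show ?thesis using \<open>open W\<close> \<open>z \<in> W\<close> by (auto simp: infty_chart_eq)
    qed
  qed
  from holomorphic_on_locally[OF this]
  show "open {z \<in> S. g z \<noteq> Infty}" "(\<lambda>z. affine_chart (g z)) holomorphic_on {z \<in> S. g z \<noteq> Infty}"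
    by blast+
qed

lemma sphere_holomorphic_infty:
  assumes "sphere_holomorphic_on g S"
  shows "open {z \<in> S. g z \<noteq> Cplx 0}" "(\<lambda>z. infty_chart (g z)) holomorphic_on {z \<in> S. g z \<noteq> Cplx 0}"
proof -
  have "\<exists>W. open W \<and> z \<in> W \<and> W \<subseteq> {z \<in> S. g z \<noteq> Cplx 0} \<and> (\<lambda>z. infty_chart (g z)) holomorphic_on W"
    if z: "z \<in> {z \<in> S. g z \<noteq> Cplx 0}" for z
  proof -
    obtain U where U: "open U" "z \<in> U" "U \<subseteq> S" and
      c: "(Infty \<notin> g ` U \<and> (\<lambda>w. affine_chart (g w)) holomorphic_on U) \<or>
         (Cplx 0 \<notin> g ` U \<and> (\<lambda>w. infty_chart (g w)) holomorphic_on U)"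
      using assms z unfolding sphere_holomorphic_on_def by blast
    from c show ?thesis
    proof
      assume "Cplx 0 \<notin> g ` U \<and> (\<lambda>w. infty_chart (g w)) holomorphic_on U"
      then show ?thesis using U by (intro exI[of _ U]) force
    next
      assume *: "Infty \<notin> g ` U \<and> (\<lambda>w. affine_chart (g w)) holomorphic_on U"
      define W where "W = {w \<in> U. affine_chart (g w) \<noteq> 0}"
      have "W = U \<inter> (\<lambda>w. affine_chart (g w)) -` (- {0})" by (auto simp: W_def)
      then have "open W"
        using * U by (metis continuous_open_preimage holomorphic_on_imp_continuous_on open_Compl closed_singleton)
      have "z \<in> W" using z U * by (cases "g z") (auto simp: W_def image_iff)
      have "(\<lambda>w. inverse (affine_chart (g w))) holomorphic_on W"
        using * by (intro holomorphic_on_inverse holomorphic_on_subset[of _ U W]) (auto simp: W_def)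
      moreover have "W \<subseteq> {z \<in> S. g z \<noteq> Cplx 0}" using U by (auto simp: W_def)
      ultimately show ?thesis using \<open>open W\<close> \<open>z \<in> W\<close> by (auto simp: infty_chart_eq)
    qed
  qed
  from holomorphic_on_locally[OF this]
  show "open {z \<in> S. g z \<noteq> Cplx 0}" "(\<lambda>z. infty_chart (g z)) holomorphic_on {z \<in> S. g z \<noteq> Cplx 0}"
    by blast+
qed

text \<open>The type of the sphere carries no topology here, so closedness of the preimage of a
  closed disc is shown in charts. At a pole the chart at infinity tends to 0, which excludes bounded
  affine values arbitrarily close by.\<close>

lemma sphere_holomorphic_bounded_limit:
  assumes g: "sphere_holomorphic_on g S" and z0: "z0 \<in> S"
    and freq: "\<exists>\<^sub>F z in nhds z0. g z \<noteq> Infty \<and> norm (affine_chart (g z) - c) \<le> M"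
  shows "g z0 \<noteq> Infty \<and> norm (affine_chart (g z0) - c) \<le> M"
proof -
  have fin: "g z0 \<noteq> Infty"
  proof
    assume "g z0 = Infty"
    let ?k = "\<lambda>z. infty_chart (g z)"
    define R where "R = \<bar>M\<bar> + norm c + 1"
    have "R > 0" by (simp add: R_def add_nonneg_pos)
    have "isCont ?k z0"
      using sphere_holomorphic_infty[OF g] z0 \<open>g z0 = Infty\<close>
      by (metis (mono_tags, lifting) continuous_on_interior holomorphic_on_imp_continuous_on interior_open mem_Collect_eq riemann_sphere.distinct(1))
    then have "(?k \<longlongrightarrow> 0) (nhds z0)" using \<open>g z0 = Infty\<close> by (simp add: isCont_def tendsto_nhds_iff)
    then have "\<forall>\<^sub>F z in nhds z0. norm (?k z) < 1 / R"
      using \<open>R > 0\<close> by (auto simp: tendsto_iff dist_norm)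
    moreover have "\<forall>\<^sub>F z in nhds z0. z \<in> {z \<in> S. g z \<noteq> Cplx 0}"
      using sphere_holomorphic_infty(1)[OF g] z0 \<open>g z0 = Infty\<close> by (intro eventually_nhds_in_open) auto
    ultimately have "\<forall>\<^sub>F z in nhds z0. \<not> (g z \<noteq> Infty \<and> norm (affine_chart (g z) - c) \<le> M)"
    proof eventually_elim
      case (elim z)
      show ?case
      proof
        assume a: "g z \<noteq> Infty \<and> norm (affine_chart (g z) - c) \<le> M"
        then have "affine_chart (g z) \<noteq> 0" using elim by (cases "g z") auto
        moreover have "norm (affine_chart (g z)) \<le> R"
          using conjunct2[OF a] norm_triangle_sub[of "affine_chart (g z)" c] abs_ge_self[of M]
          unfolding R_def by linarith
        ultimately have "1 / R \<le> 1 / norm (affine_chart (g z))"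
          using \<open>R > 0\<close> by (intro divide_left_mono) auto
        then show False using elim by (simp add: infty_chart_eq norm_inverse divide_inverse)
      qed
    qed
    then show False using freq by (simp add: frequently_def)
  qed
  have "isCont (\<lambda>z. affine_chart (g z)) z0"
    using sphere_holomorphic_affine[OF g] z0 fin
    by (metis (mono_tags, lifting) continuous_on_interior holomorphic_on_imp_continuous_on interior_open mem_Collect_eq)
  then have "((\<lambda>z. affine_chart (g z)) \<longlongrightarrow> affine_chart (g z0)) (nhds z0)"
    by (simp add: isCont_def tendsto_nhds_iff)
  then have lim: "((\<lambda>z. norm (affine_chart (g z) - c)) \<longlongrightarrow> norm (affine_chart (g z0) - c)) (nhds z0)"
    by (intro tendsto_intros)
  have "norm (affine_chart (g z0) - c) \<le> M"
  proof (rule ccontr)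
    assume "\<not> norm (affine_chart (g z0) - c) \<le> M"
    then have "\<forall>\<^sub>F z in nhds z0. norm (affine_chart (g z) - c) > M"
      using order_tendstoD(1)[OF lim] by simp
    then have "\<forall>\<^sub>F z in nhds z0. \<not> (g z \<noteq> Infty \<and> norm (affine_chart (g z) - c) \<le> M)"
      by eventually_elim auto
    then show False using freq by (simp add: frequently_def)
  qed
  then show ?thesis using fin by blast
qed

text \<open>Serves for one-sided filters: a bound valid on one side of a point of a circle or a
  radius persists at that point, and so there is no pole there.\<close>

lemma sphere_holomorphic_path_limit:
  fixes \<gamma> :: "real \<Rightarrow> complex"
  assumes g: "sphere_holomorphic_on g S" and S: "\<gamma> x \<in> S" and \<gamma>: "isCont \<gamma> x"
    and F: "F \<le> at x" "F \<noteq> bot"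
    and ev: "\<forall>\<^sub>F y in F. g (\<gamma> y) \<noteq> Infty \<and> norm (affine_chart (g (\<gamma> y)) - c) \<le> M"
  shows "g (\<gamma> x) \<noteq> Infty \<and> norm (affine_chart (g (\<gamma> x)) - c) \<le> M"
proof (rule sphere_holomorphic_bounded_limit[OF g S])
  have lim: "(\<gamma> \<longlongrightarrow> \<gamma> x) F"
    using \<gamma> F tendsto_mono unfolding isCont_def by blast
  show "\<exists>\<^sub>F z in nhds (\<gamma> x). g z \<noteq> Infty \<and> norm (affine_chart (g z) - c) \<le> M"
    unfolding frequently_def
  proof
    assume "\<forall>\<^sub>F z in nhds (\<gamma> x). \<not> (g z \<noteq> Infty \<and> norm (affine_chart (g z) - c) \<le> M)"
    then have "\<forall>\<^sub>F y in F. \<not> (g (\<gamma> y) \<noteq> Infty \<and> norm (affine_chart (g (\<gamma> y)) - c) \<le> M)"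
      using lim by (auto simp: filterlim_iff)
    with ev have "\<forall>\<^sub>F y in F. False" by eventually_elim blast
    then show False using F(2) by simp
  qed
qed

lemma open_sphere_preimage_ball:
  assumes g: "sphere_holomorphic_on g S"
  shows "open {z \<in> S. g z \<noteq> Infty \<and> norm (affine_chart (g z) - c) < e}"
proof -
  have "{z \<in> S. g z \<noteq> Infty \<and> norm (affine_chart (g z) - c) < e} =
      {z \<in> S. g z \<noteq> Infty} \<inter> (\<lambda>z. affine_chart (g z)) -` ball c e"
    by (auto simp: dist_norm norm_minus_commute)
  then show ?thesis
    using sphere_holomorphic_affine[OF g]
    by (metis continuous_open_preimage holomorphic_on_imp_continuous_on open_ball)
qed

text \<open>Factor k as \<open>h w * (w - z0) ^ n\<close> with h free of zeros. The product then has
  the size of \<open>norm (w - z0)\<close> to the power n - 1 - n b = n (1 - b) - 1, which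
  \<open>ord\<close> makes positive. A negative b is allowed, and is what simple roots (n = 1) call
  for.\<close>

lemma deriv_powr_tendsto_zero:
  fixes k :: "complex \<Rightarrow> complex" and b :: real
  assumes k: "k holomorphic_on U" and U: "open U" "z0 \<in> U" and k0: "k z0 = 0"
    and nc: "\<not> (\<forall>\<^sub>F w in at z0. k w = 0)"
    and ord: "real_of_int (zorder k z0) * (1 - b) > 1"
  shows "((\<lambda>z. norm (deriv k z) * norm (k z) powr (- b)) \<longlongrightarrow> 0) (at z0)"
proof -
  obtain r0 where r0: "r0 > 0" "ball z0 r0 \<subseteq> U" using U open_contains_ball by blast
  have "\<exists>w\<in>ball z0 r0. k w \<noteq> 0"
  proof (rule ccontr)
    assume "\<not> ?thesis"
    then have "\<forall>\<^sub>F w in at z0. k w = 0"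
      using r0 unfolding eventually_at by (auto simp: dist_commute intro!: exI[of _ r0])
    then show False using nc by blast
  qed
  from zorder_exist_zero[OF holomorphic_on_subset[OF k r0(2)] open_ball connected_ball _ this] r0 k0
  obtain h r where n: "zorder k z0 > 0" and r: "r > 0" and hh: "h holomorphic_on cball z0 r"
    and kh: "\<And>w. w \<in> cball z0 r \<Longrightarrow> k w = h w * (w - z0) ^ nat (zorder k z0) \<and> h w \<noteq> 0"
    by (metis centre_in_ball)
  define n where "n = nat (zorder k z0)"
  obtain m where m: "n = Suc m" using n by (cases n) (auto simp: n_def)
  have hb: "h holomorphic_on ball z0 r" using hh holomorphic_on_subset ball_subset_cball by blast
  have h0: "h z0 \<noteq> 0" using kh[of z0] r by auto
  have ch: "isCont h z0" "isCont (deriv h) z0"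
    using hb holomorphic_deriv[OF hb] r
    by (metis open_ball centre_in_ball continuous_on_interior holomorphic_on_imp_continuous_on interior_open)+
  have real_n: "real_of_int (zorder k z0) = real n" using n by (simp add: n_def)
  have eq: "norm (deriv k w) * norm (k w) powr (- b) =
      norm (deriv h w * (w - z0) + of_nat n * h w) * norm (h w) powr (- b) * norm (w - z0) powr (real n * (1 - b) - 1)"
    if w: "w \<in> ball z0 r" "w \<noteq> z0" for w
  proof -
    have "((\<lambda>w. h w * (w - z0) ^ n) has_field_derivative
        deriv h w * (w - z0) ^ n + h w * (of_nat n * (w - z0) ^ m)) (at w)"
    proof -
      have "((\<lambda>w. w - z0) has_field_derivative 1) (at w)" by (auto intro!: derivative_eq_intros)
      from DERIV_power[OF this, of n]
      have "((\<lambda>w. (w - z0) ^ n) has_field_derivative of_nat n * (w - z0) ^ m) (at w)"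
        by (simp add: m)
      from DERIV_mult'[OF holomorphic_derivI[OF hb open_ball w(1)] this] show ?thesis
        by (simp add: add.commute)
    qed
    then have "(k has_field_derivative deriv h w * (w - z0) ^ n + h w * (of_nat n * (w - z0) ^ m)) (at w)"
      by (rule has_field_derivative_transform_within_open[OF _ open_ball w(1)]) (use kh in \<open>auto simp: n_def\<close>)
    then have "deriv k w = (deriv h w * (w - z0) + of_nat n * h w) * (w - z0) ^ m"
      by (simp add: DERIV_imp_deriv m algebra_simps)
    then have d: "norm (deriv k w) = norm (deriv h w * (w - z0) + of_nat n * h w) * norm (w - z0) powr real m"
      using w by (simp add: norm_mult norm_power powr_realpow)
    have "norm (k w) = norm (h w) * norm (w - z0) powr real n"
      using kh[of w] w by (simp add: n_def[symmetric] norm_mult norm_power powr_realpow)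
    then have "norm (k w) powr (- b) = norm (h w) powr (- b) * norm (w - z0) powr (real n * - b)"
      by (simp add: powr_mult powr_powr)
    moreover have "norm (w - z0) powr real m * norm (w - z0) powr (real n * - b)
        = norm (w - z0) powr (real n * (1 - b) - 1)"
      unfolding powr_add[symmetric] by (simp add: m algebra_simps)
    ultimately show ?thesis using d by (simp add: mult_ac)
  qed
  have "((\<lambda>w. norm (w - z0)) \<longlongrightarrow> 0) (at z0)"
    using tendsto_norm[OF tendsto_diff[OF tendsto_ident_at tendsto_const[of z0]], of z0 UNIV] by simp
  then have p: "((\<lambda>w. norm (w - z0) powr (real n * (1 - b) - 1)) \<longlongrightarrow> 0) (at z0)"
    using ord unfolding real_n by (intro tendsto_zero_powrI[OF _ tendsto_const]) auto
  have "((\<lambda>w. norm (deriv h w * (w - z0) + of_nat n * h w) * norm (h w) powr (- b)) \<longlongrightarrow>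
      norm (deriv h z0 * (z0 - z0) + of_nat n * h z0) * norm (h z0) powr (- b)) (at z0)"
    using ch h0 unfolding isCont_def by (intro tendsto_intros) auto
  from tendsto_mult[OF this p]
  have "((\<lambda>w. norm (deriv h w * (w - z0) + of_nat n * h w) * norm (h w) powr (- b) * norm (w - z0) powr (real n * (1 - b) - 1))
      \<longlongrightarrow> 0) (at z0)" by simp
  then show ?thesis
    by (rule Lim_transform_within_open[where s = "ball z0 r"]) (use r eq in auto)
qed

section \<open>Continuity of the pullback across roots and poles\<close>

context cone_metric begin

lemma continuous_on_\<rho>: "continuous_on (- A) \<rho>"
proof -
  have *: "1 + exp y \<noteq> 0" for y :: real
    using exp_gt_zero[of y] by linarith
  show ?thesis unfolding \<rho>_def by (intro continuous_intros) (auto simp: *)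
qed

text \<open>For a \<open>ramified\<close> map the value 0 over \<open>A\<close> and at poles is the
  limit there, which makes the function continuous.\<close>

definition pullback :: "(complex \<Rightarrow> riemann_sphere) \<Rightarrow> complex \<Rightarrow> real" where
  "pullback g z = (if g z \<in> insert Infty (Cplx ` A) then 0
     else \<rho> (affine_chart (g z)) * norm (deriv (\<lambda>w. affine_chart (g w)) z))"

lemma pullback_nonneg: "0 \<le> pullback g z"
  using \<rho>_pos by (simp add: pullback_def less_imp_le)

text \<open>The inequalities are the exponent condition of \<open>deriv_powr_tendsto_zero\<close>.
  Local constancy is a separate alternative because \<open>zorder\<close> carries no information
  there. Poles are constrained even if infinity is not among the given values, since the metric has
  an exponent there in any case.\<close>

definition ramified :: "(complex \<Rightarrow> riemann_sphere) \<Rightarrow> complex set \<Rightarrow> bool" where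
  "ramified g S \<longleftrightarrow>
    (\<forall>z\<in>S. \<forall>a\<in>A. g z = Cplx a \<longrightarrow> (\<forall>\<^sub>F w in at z. g w = Cplx a) \<or>
        1 < real_of_int (zorder (\<lambda>w. affine_chart (g w) - a) z) * (1 - b a)) \<and>
    (\<forall>z\<in>S. g z = Infty \<longrightarrow> (\<forall>\<^sub>F w in at z. g w = Infty) \<or>
        1 < real_of_int (zorder (\<lambda>w. infty_chart (g w)) z) * (1 - \<beta>))"

lemma pullback_tendsto_zero_finite:
  assumes g: "sphere_holomorphic_on g S" and z: "z \<in> S" "g z = Cplx a" "a \<in> A" and ram: "ramified g S"
  shows "(pullback g \<longlongrightarrow> 0) (at z)"
proof (cases "\<forall>\<^sub>F w in at z. g w = Cplx a")
  case True
  then have "\<forall>\<^sub>F w in at z. pullback g w = 0"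
    by eventually_elim (use z in \<open>auto simp: pullback_def\<close>)
  then show ?thesis by (rule tendsto_eventually)
next
  case False
  define f where "f w = affine_chart (g w)" for w
  define X where "X = {w \<in> S. g w \<noteq> Infty}"
  have X: "open X" "f holomorphic_on X" "z \<in> X"
    using sphere_holomorphic_affine[OF g] z by (simp_all add: X_def f_def[abs_def])
  have evX: "\<forall>\<^sub>F w in at z. w \<in> X"
    using eventually_nhds_in_open[OF X(1,3)] by (auto simp: eventually_at_filter elim: eventually_mono)
  have fz: "f z = a" using z by (simp add: f_def)
  have "isCont f z" using X by (metis continuous_on_interior holomorphic_on_imp_continuous_on interior_open)
  then have lim: "(f \<longlongrightarrow> a) (at z)" using fz by (simp add: isCont_def)
  have nc: "\<not> (\<forall>\<^sub>F w in at z. f w - a = 0)"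
  proof
    assume "\<forall>\<^sub>F w in at z. f w - a = 0"
    with evX have "\<forall>\<^sub>F w in at z. g w = Cplx a"
    proof eventually_elim
      case (elim w) then show ?case by (cases "g w") (auto simp: f_def X_def)
    qed
    then show False using False by blast
  qed
  have ord: "1 < real_of_int (zorder (\<lambda>w. f w - a) z) * (1 - b a)"
    using ram z False unfolding ramified_def f_def by auto
  have "(\<lambda>w. f w - a) holomorphic_on X" using X by (intro holomorphic_intros)
  from deriv_powr_tendsto_zero[OF this X(1,3) _ nc ord] fz
  have T: "((\<lambda>w. norm (deriv (\<lambda>w. f w - a) w) * norm (f w - a) powr - b a) \<longlongrightarrow> 0) (at z)" by simp
  obtain C where "\<forall>\<^sub>F w in at a. \<rho> w \<le> C * norm (w - a) powr (- b a)"
    using \<rho>_le_near[OF z(3)] by blast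
  then have "\<forall>\<^sub>F w in nhds a. w \<noteq> a \<longrightarrow> \<rho> w \<le> C * norm (w - a) powr (- b a)"
    by (simp add: eventually_at_filter)
  with lim have ev: "\<forall>\<^sub>F w in at z. f w \<noteq> a \<longrightarrow> \<rho> (f w) \<le> C * norm (f w - a) powr (- b a)"
    by (auto simp: filterlim_iff)
  have "\<forall>\<^sub>F w in at z. norm (pullback g w) \<le> \<bar>C\<bar> * (norm (deriv (\<lambda>w. f w - a) w) * norm (f w - a) powr - b a)"
    using ev evX
  proof eventually_elim
    case (elim w)
    show ?case
    proof (cases "g w \<in> insert Infty (Cplx ` A)")
      case True then show ?thesis by (simp add: pullback_def)
    next
      case False
      then have "f w \<noteq> a" using z elim by (cases "g w") (auto simp: f_def)
      then have "\<rho> (f w) \<le> \<bar>C\<bar> * norm (f w - a) powr (- b a)"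
        using elim by (meson abs_ge_self mult_right_mono order_trans powr_ge_zero)
      then have "\<rho> (f w) * norm (deriv f w) \<le> \<bar>C\<bar> * norm (f w - a) powr (- b a) * norm (deriv f w)"
        by (intro mult_right_mono) auto
      moreover have "deriv (\<lambda>w. f w - a) w = deriv f w"
        using X elim by (subst deriv_diff) (auto intro: holomorphic_on_imp_differentiable_at)
      ultimately show ?thesis
        using False \<rho>_pos[of "f w"] by (simp add: pullback_def f_def[abs_def] mult_ac)
    qed
  qed
  moreover have "((\<lambda>w. \<bar>C\<bar> * (norm (deriv (\<lambda>w. f w - a) w) * norm (f w - a) powr - b a)) \<longlongrightarrow> 0) (at z)"
    using tendsto_mult[OF tendsto_const[of "\<bar>C\<bar>"] T] by simp
  ultimately show ?thesis by (rule Lim_null_comparison)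
qed

text \<open>With k = 1/f the derivative of f has modulus
  \<open>norm (deriv k w) / (norm (k w))\<^sup>2\<close>. This turns the decay of the density with
  exponent \<open>\<beta> - 2\<close> into the exponent \<open>- \<beta>\<close> in k, so that
  infinity behaves like the other cone points.\<close>

lemma pullback_tendsto_zero_pole:
  assumes g: "sphere_holomorphic_on g S" and z: "z \<in> S" "g z = Infty" and ram: "ramified g S"
  shows "(pullback g \<longlongrightarrow> 0) (at z)"
proof (cases "\<forall>\<^sub>F w in at z. g w = Infty")
  case True
  then have "\<forall>\<^sub>F w in at z. pullback g w = 0"
    by eventually_elim (use z in \<open>auto simp: pullback_def\<close>)
  then show ?thesis by (rule tendsto_eventually)
next
  case False
  define f where "f w = affine_chart (g w)" for w
  define k where "k w = infty_chart (g w)" for w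
  define X where "X = {w \<in> S. g w \<noteq> Cplx 0}"
  have X: "open X" "k holomorphic_on X" "z \<in> X"
    using sphere_holomorphic_infty[OF g] z by (simp_all add: X_def k_def[abs_def])
  have evX: "\<forall>\<^sub>F w in at z. w \<in> X"
    using eventually_nhds_in_open[OF X(1,3)] by (auto simp: eventually_at_filter elim: eventually_mono)
  have kz: "k z = 0" using z by (simp add: k_def)
  have contk: "continuous_on X k" using X by (intro holomorphic_on_imp_continuous_on)
  then have "isCont k z" using X by (metis continuous_on_interior interior_open)
  then have lim: "(k \<longlongrightarrow> 0) (at z)" using kz by (simp add: isCont_def)
  have nc: "\<not> (\<forall>\<^sub>F w in at z. k w = 0)"
  proof
    assume "\<forall>\<^sub>F w in at z. k w = 0"
    with evX have "\<forall>\<^sub>F w in at z. g w = Infty"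
    proof eventually_elim
      case (elim w) then show ?case by (cases "g w") (auto simp: k_def X_def)
    qed
    then show False using False by blast
  qed
  have ord: "1 < real_of_int (zorder k z) * (1 - \<beta>)"
    using ram z False unfolding ramified_def k_def[abs_def] by auto
  from deriv_powr_tendsto_zero[OF X(2,1,3) kz nc ord]
  have T: "((\<lambda>w. norm (deriv k w) * norm (k w) powr - \<beta>) \<longlongrightarrow> 0) (at z)" .
  obtain C where "\<forall>\<^sub>F w in at_infinity. w \<notin> A \<and> \<rho> w \<le> C * norm w powr (\<beta> - 2)"
    using \<rho>_le_at_infinity by blast
  then obtain M where M: "\<And>w. M \<le> norm w \<Longrightarrow> \<rho> w \<le> C * norm w powr (\<beta> - 2)"
    by (auto simp: eventually_at_infinity)
  have "\<forall>\<^sub>F w in at z. norm (k w) < 1 / (\<bar>M\<bar> + 1)"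
    using lim by (auto simp: tendsto_iff dist_norm add_nonneg_pos)
  with evX have "\<forall>\<^sub>F w in at z. norm (pullback g w) \<le> \<bar>C\<bar> * (norm (deriv k w) * norm (k w) powr - \<beta>)"
  proof eventually_elim
    case (elim w)
    show ?case
    proof (cases "g w \<in> insert Infty (Cplx ` A)")
      case True then show ?thesis by (simp add: pullback_def)
    next
      case False
      then have kw: "k w \<noteq> 0" using elim by (cases "g w") (auto simp: k_def X_def)
      have fk: "f w = inverse (k w)" for w by (simp add: f_def k_def infty_chart_eq)
      have "\<bar>M\<bar> + 1 < 1 / norm (k w)" using elim kw by (simp add: field_simps)
      then have "M \<le> norm (f w)" by (simp add: fk norm_inverse divide_inverse)
      then have "\<rho> (f w) \<le> C * norm (f w) powr (\<beta> - 2)" by (rule M)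
      also have "norm (f w) powr (\<beta> - 2) = norm (k w) powr (2 - \<beta>)"
        using kw powr_minus[of "norm (k w)" "\<beta> - 2"] by (simp add: fk norm_inverse inverse_powr)
      also have "C * norm (k w) powr (2 - \<beta>) \<le> \<bar>C\<bar> * norm (k w) powr (2 - \<beta>)"
        by (intro mult_right_mono) auto
      finally have "\<rho> (f w) * norm (deriv f w) \<le> \<bar>C\<bar> * norm (k w) powr (2 - \<beta>) * norm (deriv f w)"
        by (intro mult_right_mono) auto
      moreover have "deriv f w = - deriv k w / (k w)\<^sup>2"
      proof -
        have "((\<lambda>w. inverse (k w)) has_field_derivative - (inverse (k w) * deriv k w * inverse (k w))) (at w)"
          using holomorphic_derivI[OF X(2,1)] elim kw by (intro DERIV_inverse') auto
        then show ?thesis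
          using kw unfolding fk[abs_def] by (simp add: DERIV_imp_deriv field_simps power2_eq_square)
      qed
      moreover have "norm (k w) powr (2 - \<beta>) = norm (k w) powr - \<beta> * (norm (k w))\<^sup>2"
        using kw powr_add[of "norm (k w)" "- \<beta>" 2] by simp
      ultimately have "\<rho> (f w) * norm (deriv f w) \<le> \<bar>C\<bar> * (norm (deriv k w) * norm (k w) powr - \<beta>)"
        using kw by (simp add: norm_divide norm_power mult_ac)
      then show ?thesis
        using False \<rho>_pos[of "f w"] by (simp add: pullback_def f_def[abs_def])
    qed
  qed
  moreover have "((\<lambda>w. \<bar>C\<bar> * (norm (deriv k w) * norm (k w) powr - \<beta>)) \<longlongrightarrow> 0) (at z)"
    using tendsto_mult[OF tendsto_const[of "\<bar>C\<bar>"] T] by simp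
  ultimately show ?thesis by (rule Lim_null_comparison)
qed

lemma open_regular_part:
  assumes g: "sphere_holomorphic_on g S"
  shows "open {w \<in> S. g w \<notin> insert Infty (Cplx ` A)}"
proof -
  have "{w \<in> S. g w \<notin> insert Infty (Cplx ` A)} = {w \<in> S. g w \<noteq> Infty} \<inter> (\<lambda>w. affine_chart (g w)) -` (- A)"
  proof (intro set_eqI)
    fix w show "w \<in> {w \<in> S. g w \<notin> insert Infty (Cplx ` A)} \<longleftrightarrow>
        w \<in> {w \<in> S. g w \<noteq> Infty} \<inter> (\<lambda>w. affine_chart (g w)) -` (- A)"
      by (cases "g w") auto
  qed
  then show ?thesis
    using continuous_open_preimage[OF holomorphic_on_imp_continuous_on[OF sphere_holomorphic_affine(2)[OF g]]
        sphere_holomorphic_affine(1)[OF g] open_Compl[OF finite_imp_closed[OF fin]]]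
    by simp
qed

lemma isCont_pullback:
  assumes g: "sphere_holomorphic_on g S" and z: "z \<in> S" and ram: "ramified g S"
  shows "isCont (pullback g) z"
proof (cases "g z \<in> insert Infty (Cplx ` A)")
  case True
  then have "pullback g z = 0" by (simp add: pullback_def)
  moreover have "(pullback g \<longlongrightarrow> 0) (at z)"
    using True pullback_tendsto_zero_finite[OF g z] pullback_tendsto_zero_pole[OF g z] ram by auto
  ultimately show ?thesis by (simp add: isCont_def)
next
  case False
  define f where "f w = affine_chart (g w)" for w
  define X where "X = {w \<in> S. g w \<notin> insert Infty (Cplx ` A)}"
  have oX: "open X" unfolding X_def by (rule open_regular_part[OF g])
  have "f holomorphic_on {w \<in> S. g w \<noteq> Infty}"
    using sphere_holomorphic_affine(2)[OF g] by (simp add: f_def[abs_def])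
  then have f: "f holomorphic_on X" by (rule holomorphic_on_subset) (auto simp: X_def)
  have "f ` X \<subseteq> - A"
  proof
    fix y assume "y \<in> f ` X"
    then obtain w where "w \<in> X" "y = f w" by blast
    then show "y \<in> - A" by (cases "g w") (auto simp: f_def X_def)
  qed
  then have "continuous_on X (\<lambda>w. \<rho> (f w) * norm (deriv f w))"
    using continuous_on_compose2[OF continuous_on_\<rho> holomorphic_on_imp_continuous_on[OF f]]
      holomorphic_on_imp_continuous_on[OF holomorphic_deriv[OF f oX]]
    by (intro continuous_on_mult continuous_on_norm)
  moreover have "pullback g w = \<rho> (f w) * norm (deriv f w)" if "w \<in> X" for w
    using that by (simp add: pullback_def f_def[abs_def] X_def)
  ultimately have "continuous_on X (pullback g)" by (simp cong: continuous_on_cong)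
  then show ?thesis using z False oX by (simp add: continuous_on_eq_continuous_at X_def)
qed

text \<open>The point \<open>Ln z\<close> has distance \<open>- ln (norm z)\<close> from the
  imaginary axis, which is the radius available to \<open>ahlfors_schwarz\<close>; the factor
  \<open>norm z\<close> is the modulus of the derivative of \<open>exp\<close> there.\<close>

lemma pullback_bound_punctured_disc:
  assumes g: "sphere_holomorphic_on g (ball 0 1 - {0})" and ram: "ramified g (ball 0 1 - {0})"
  obtains C where "\<And>z. z \<in> ball 0 1 - {0} \<Longrightarrow> pullback g z * norm z * (- ln (norm z)) \<le> C"
proof -
  let ?S = "ball 0 1 - {0::complex}"
  obtain C where C: "\<And>c r U. 0 < r \<Longrightarrow> continuous_on (ball c r) U \<Longrightarrow> (\<And>z. z \<in> ball c r \<Longrightarrow> 0 \<le> U z) \<Longrightarrow>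
    (\<And>z. z \<in> ball c r \<Longrightarrow> U z > 0 \<Longrightarrow> \<exists>V F. open V \<and> z \<in> V \<and> F holomorphic_on V \<and>
        (\<forall>w\<in>V. F w \<notin> A \<and> deriv F w \<noteq> 0 \<and> U w = \<rho> (F w) * norm (deriv F w))) \<Longrightarrow>
    U c \<le> C / r"
    using ahlfors_schwarz by blast
  show ?thesis
  proof (rule that[of C])
    fix z assume z: "z \<in> ?S"
    define \<zeta> where "\<zeta> = Ln z"
    define r where "r = - ln (norm z)"
    have r: "0 < r" using z by (simp add: r_def)
    have Re\<zeta>: "Re \<zeta> = - r" using z by (simp add: \<zeta>_def r_def)
    have expS: "exp w \<in> ?S" if "w \<in> ball \<zeta> r" for w
    proof -
      have "Re w - Re \<zeta> \<le> norm (w - \<zeta>)" using complex_Re_le_cmod[of "w - \<zeta>"] by simp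
      then have "Re w < 0" using that Re\<zeta> by (simp add: dist_norm norm_minus_commute)
      then show ?thesis by simp
    qed
    define U where "U w = pullback g (exp w) * norm (exp w)" for w
    define f where "f w = affine_chart (g w)" for w
    define X where "X = {w \<in> ?S. g w \<notin> insert Infty (Cplx ` A)}"
    have oX: "open X" unfolding X_def by (rule open_regular_part[OF g])
    have "f holomorphic_on {w \<in> ?S. g w \<noteq> Infty}"
      using sphere_holomorphic_affine(2)[OF g] by (simp add: f_def[abs_def])
    then have f: "f holomorphic_on X" by (rule holomorphic_on_subset) (auto simp: X_def)
    \<comment> \<open>Critical points of f are removed too: they are zeros of \<open>U\<close>, and
      a representation is required only where \<open>U\<close> is positive.\<close>
    define Y where "Y = X \<inter> deriv f -` (- {0})"
    have oY: "open Y" unfolding Y_def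
      by (intro continuous_open_preimage holomorphic_on_imp_continuous_on holomorphic_deriv f oX) auto
    have "U \<zeta> \<le> C / r"
    proof (rule C[OF r])
      show "continuous_on (ball \<zeta> r) U"
      proof (rule continuous_at_imp_continuous_on, rule ballI)
        fix w assume "w \<in> ball \<zeta> r"
        then have "isCont (\<lambda>w. pullback g (exp w)) w"
          using isCont_o2[where f = exp and g = "pullback g"] isCont_pullback[OF g expS ram] isCont_exp by auto
        then show "isCont U w" unfolding U_def by (intro continuous_intros)
      qed
      show "0 \<le> U w" for w using pullback_nonneg by (simp add: U_def)
      fix w assume w: "w \<in> ball \<zeta> r" "U w > 0"
      define V where "V = exp -` Y"
      have "open V" unfolding V_def using oY by (intro open_vimage continuous_intros)
      have "pullback g (exp w) \<noteq> 0" using w(2) by (auto simp: U_def)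
      then have "exp w \<in> Y" using expS[OF w(1)]
        by (auto simp: Y_def X_def pullback_def f_def[abs_def] split: if_splits)
      then have "w \<in> V" by (simp add: V_def)
      have F: "((\<lambda>w. f (exp w)) has_field_derivative deriv f (exp v) * exp v) (at v)" if "v \<in> V" for v
        using holomorphic_derivI[OF f oX, of "exp v"] that DERIV_chain2[OF _ DERIV_exp]
        by (auto simp: V_def Y_def)
      have dF: "deriv (\<lambda>w. f (exp w)) v = deriv f (exp v) * exp v" if "v \<in> V" for v
        using F[OF that] by (rule DERIV_imp_deriv)
      have "(\<lambda>w. f (exp w)) holomorphic_on V"
        using F \<open>open V\<close> by (auto simp: holomorphic_on_open)
      moreover have "f (exp v) \<notin> A \<and> deriv (\<lambda>w. f (exp w)) v \<noteq> 0 \<and>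
          U v = \<rho> (f (exp v)) * norm (deriv (\<lambda>w. f (exp w)) v)" if "v \<in> V" for v
      proof -
        have X: "exp v \<in> X" "deriv f (exp v) \<noteq> 0" using that by (auto simp: V_def Y_def)
        then have "f (exp v) \<notin> A" by (cases "g (exp v)") (auto simp: X_def f_def)
        then show ?thesis using X dF[OF that]
          by (simp add: U_def pullback_def X_def f_def[abs_def] norm_mult)
      qed
      ultimately show "\<exists>V F. open V \<and> w \<in> V \<and> F holomorphic_on V \<and>
        (\<forall>w\<in>V. F w \<notin> A \<and> deriv F w \<noteq> 0 \<and> U w = \<rho> (F w) * norm (deriv F w))"
        using \<open>open V\<close> \<open>w \<in> V\<close> by (intro exI[of _ V] exI[of _ "\<lambda>w. f (exp w)"]) auto
    qed
    then show "pullback g z * norm z * (- ln (norm z)) \<le> C"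
      using r z by (simp add: U_def \<zeta>_def r_def field_simps)
  qed
qed

end

section \<open>Removing a puncture with small circles\<close>

text \<open>\<open>M\<close> is universally quantified, and the bound may depend on it: the
  derivative is controlled over each bounded set of values, with no uniformity towards the
  poles.\<close>

locale small_circles =
  fixes g :: "complex \<Rightarrow> riemann_sphere"
  assumes g: "sphere_holomorphic_on g (ball 0 1 - {0})"
    and bd: "\<exists>B. \<forall>z\<in>ball 0 1 - {0}. g z \<noteq> Infty \<longrightarrow> norm (affine_chart (g z)) \<le> M \<longrightarrow>
      norm (deriv (\<lambda>w. affine_chart (g w)) z) * norm z * (- ln (norm z)) \<le> B"
begin

abbreviation "f \<equiv> \<lambda>z. affine_chart (g z)"

text \<open>The derivative is controlled only while \<open>norm (f z) \<le> K + \<kappa>\<close>, so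
  the circle is followed from \<open>z1\<close> to the first angle at which the
  \<kappa>-neighbourhood of \<open>f z1\<close> is left. Up to there the estimate gives the better
  bound \<open>\<kappa> / 2\<close>, which persists in the limit and contradicts the exit.\<close>

lemma circle_oscillation:
  assumes \<kappa>: "0 < \<kappa>"
  obtains r0 where "0 < r0" "r0 < 1"
    "\<And>z1 z2 :: complex. norm z1 = norm z2 \<Longrightarrow> 0 < norm z1 \<Longrightarrow> norm z1 < r0 \<Longrightarrow> g z1 \<noteq> Infty \<Longrightarrow> norm (f z1) \<le> K \<Longrightarrow>
       g z2 \<noteq> Infty \<and> norm (f z2 - f z1) < \<kappa>"
proof -
  let ?S = "ball 0 1 - {0::complex}"
  define X where "X = {z \<in> ?S. g z \<noteq> Infty}"
  have X: "open X" "f holomorphic_on X"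
    unfolding X_def using sphere_holomorphic_affine[OF g] by blast+
  obtain B where B: "\<And>z. z \<in> ?S \<Longrightarrow> g z \<noteq> Infty \<Longrightarrow> norm (f z) \<le> K + \<kappa> \<Longrightarrow>
      norm (deriv f z) * norm z * (- ln (norm z)) \<le> B"
    using bd[of "K + \<kappa>"] by blast
  \<comment> \<open>Chosen so that \<open>\<bar>B\<bar> / L\<close> is below \<kappa> / (4 \<pi>),
    the \<open>q\<close> below; an arc of angle at most 2 \<pi> then moves \<open>f\<close> by at
    most \<open>\<kappa> / 2\<close>. The added 1 keeps \<open>L\<close> positive.\<close>
  define L where "L = 4 * pi * (\<bar>B\<bar> + 1) / \<kappa>"
  have "L > 0" using \<kappa> by (auto simp: L_def intro!: divide_pos_pos mult_pos_pos add_nonneg_pos)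
  define q where "q = \<kappa> / (4 * pi)"
  have "q > 0" using \<kappa> by (simp add: q_def)
  have small: "norm (deriv f z) * norm z \<le> q"
    if "z \<in> ?S" "norm z < exp (- L)" "g z \<noteq> Infty" "norm (f z) \<le> K + \<kappa>" for z
  proof -
    have "ln (norm z) < ln (exp (- L))" using that by (subst ln_less_cancel_iff) auto
    then have "norm (deriv f z) * norm z * L \<le> norm (deriv f z) * norm z * (- ln (norm z))"
      by (intro mult_left_mono) auto
    also have "\<dots> \<le> B" using B that by blast
    also have "\<dots> \<le> q * L" using \<kappa> by (simp add: q_def L_def)
    finally show ?thesis using \<open>L > 0\<close> by simp
  qed
  show ?thesis
  proof (rule that[of "exp (- L)"])
    show "exp (- L) < 1" using \<open>L > 0\<close> by simp
    fix z1 z2 :: complex assume z: "norm z1 = norm z2" "0 < norm z1" "norm z1 < exp (- L)"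
      and fin: "g z1 \<noteq> Infty" and K: "norm (f z1) \<le> K"
    \<comment> \<open>The parameter is complex so that the mean value bound for complex derivatives
      applies to \<open>f (\<gamma> w)\<close> on a real segment.\<close>
    define \<gamma> where "\<gamma> w = z1 * exp (\<i> * w)" for w
    define \<theta>2 where "\<theta>2 = Arg2pi (z2 / z1)"
    have "norm (z2 / z1) = 1" using z by (simp add: norm_divide)
    then have "z2 / z1 = exp (\<i> * of_real \<theta>2)"
      using Arg2pi_eq[of "z2 / z1"] unfolding \<theta>2_def by simp
    then have \<theta>2: "0 \<le> \<theta>2" "\<theta>2 < 2 * pi" "\<gamma> (of_real \<theta>2) = z2"
      using Arg2pi[of "z2 / z1"] z by (auto simp: \<theta>2_def \<gamma>_def field_simps)
    have norm\<gamma>: "norm (\<gamma> (of_real x)) = norm z1" for x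
      by (simp add: \<gamma>_def norm_mult)
    have \<gamma>S: "\<gamma> (of_real x) \<in> ?S" for x
    proof -
      have "norm z1 < 1" using z(3) \<open>exp (- L) < 1\<close> by linarith
      then show ?thesis using norm\<gamma>[of x] z by auto
    qed
    have cont: "continuous_on UNIV (\<lambda>x. \<gamma> (of_real x))"
      unfolding \<gamma>_def by (intro continuous_intros)
    define \<Omega> where "\<Omega> = {z \<in> ?S. g z \<noteq> Infty \<and> norm (f z - f z1) < \<kappa>}"
    have "open \<Omega>" unfolding \<Omega>_def by (rule open_sphere_preimage_ball[OF g])
    define V where "V = {0..\<theta>2} \<inter> (\<lambda>x. \<gamma> (of_real x)) -` (- \<Omega>)"
    have "compact V" unfolding V_def
      using \<open>open \<Omega>\<close> cont by (intro compact_Int_closed compact_Icc closed_vimage) auto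
    have "V = {}"
    proof (rule ccontr)
      assume "V \<noteq> {}"
      from compact_attains_inf[OF \<open>compact V\<close> this] obtain \<theta>0 where
        \<theta>0: "\<theta>0 \<in> V" "\<And>x. x \<in> V \<Longrightarrow> \<theta>0 \<le> x" by blast
      have "z1 \<in> \<Omega>" using \<gamma>S[of 0] fin \<kappa> by (simp add: \<Omega>_def \<gamma>_def)
      then have "\<theta>0 \<noteq> 0" using \<theta>0(1) by (auto simp: V_def \<gamma>_def)
      then have pos: "0 < \<theta>0" using \<theta>0(1) by (simp add: V_def)
      have in\<Omega>: "\<gamma> (of_real x) \<in> \<Omega>" if "0 \<le> x" "x < \<theta>0" for x
      proof (rule ccontr)
        assume "\<gamma> (of_real x) \<notin> \<Omega>"
        then have "x \<in> V" using \<theta>0(1) that by (simp add: V_def)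
        then show False using \<theta>0(2)[of x] that by simp
      qed
      have est: "norm (f (\<gamma> (of_real x)) - f z1) \<le> \<kappa> / 2" if x: "0 < x" "x < \<theta>0" for x
      proof -
        have "norm (f (\<gamma> (of_real x)) - f (\<gamma> 0)) \<le> q * norm (of_real x - (0::complex))"
        proof (rule field_differentiable_bound[OF convex_closed_segment])
          fix w :: complex assume "w \<in> closed_segment 0 (of_real x)"
          then obtain u where u: "w = of_real (u * x)" "0 \<le> u" "u \<le> 1"
            by (auto simp: in_segment scaleR_conv_of_real)
          have ux: "0 \<le> u * x" "u * x < \<theta>0"
          proof -
            show "0 \<le> u * x" using u(2) x by simp
            have "u * x \<le> x" using u(3) x by simp
            then show "u * x < \<theta>0" using x by linarith
          qed
          have w\<Omega>: "\<gamma> w \<in> \<Omega>" using in\<Omega>[OF ux] u by simp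
          then have "\<gamma> w \<in> X" by (simp add: \<Omega>_def X_def)
          have "(\<gamma> has_field_derivative \<i> * \<gamma> w) (at w)"
            unfolding \<gamma>_def by (auto intro!: derivative_eq_intros)
          from DERIV_chain2[OF holomorphic_derivI[OF X(2,1) \<open>\<gamma> w \<in> X\<close>] this]
          show "((\<lambda>w. f (\<gamma> w)) has_field_derivative deriv f (\<gamma> w) * (\<i> * \<gamma> w))
              (at w within closed_segment 0 (of_real x))"
            by (rule has_field_derivative_at_within)
          have "norm (f (\<gamma> w)) \<le> K + \<kappa>"
            using w\<Omega> K norm_triangle_sub[of "f (\<gamma> w)" "f z1"] by (simp add: \<Omega>_def)
          then show "norm (deriv f (\<gamma> w) * (\<i> * \<gamma> w)) \<le> q"
            using small[of "\<gamma> w"] w\<Omega> z norm\<gamma>[of "u * x"] u by (simp add: \<Omega>_def norm_mult)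
        qed auto
        also have "\<dots> \<le> q * (2 * pi)"
          using x \<theta>0(1) \<theta>2 \<open>q > 0\<close> by (intro mult_left_mono) (auto simp: V_def)
        also have "\<dots> = \<kappa> / 2" by (simp add: q_def)
        finally show ?thesis by (simp add: \<gamma>_def)
      qed
      have "\<forall>\<^sub>F x in at_left \<theta>0. x \<in> {0<..<\<theta>0}"
        using eventually_at_left_real[OF pos] .
      then have ev: "\<forall>\<^sub>F x in at_left \<theta>0. g (\<gamma> (of_real x)) \<noteq> Infty \<and> norm (f (\<gamma> (of_real x)) - f z1) \<le> \<kappa> / 2"
      proof eventually_elim
        case (elim x) then show ?case using in\<Omega>[of x] est[of x] by (auto simp: \<Omega>_def)
      qed
      have "isCont (\<lambda>x. \<gamma> (of_real x)) \<theta>0" using cont by (simp add: continuous_on_eq_continuous_at)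
      from sphere_holomorphic_path_limit[OF g \<gamma>S this at_le _ ev]
      have "g (\<gamma> (of_real \<theta>0)) \<noteq> Infty \<and> norm (f (\<gamma> (of_real \<theta>0)) - f z1) \<le> \<kappa> / 2" by simp
      then have "\<gamma> (of_real \<theta>0) \<in> \<Omega>" using \<gamma>S[of \<theta>0] \<kappa> by (simp add: \<Omega>_def)
      then show False using \<theta>0(1) by (simp add: V_def)
    qed
    then have "\<gamma> (of_real \<theta>2) \<in> \<Omega>" using \<theta>2 by (auto simp: V_def)
    then show "g z2 \<noteq> Infty \<and> norm (f z2 - f z1) < \<kappa>" using \<theta>2 by (simp add: \<Omega>_def)
  qed simp
qed

text \<open>The values on the two boundary circles are close to \<open>f zs\<close> and
  \<open>f zt\<close>, which may be far from each other. The maximum principle is therefore applied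
  to the product of both differences: on each circle one factor is small and the other bounded,
  whereas at \<open>z1\<close> both are at least \<open>\<delta> - \<kappa>\<close>.\<close>

lemma cluster_value_is_limit:
  assumes cl: "\<And>d e. 0 < d \<Longrightarrow> 0 < e \<Longrightarrow> \<exists>z. 0 < norm z \<and> norm z < d \<and> g z \<noteq> Infty \<and> norm (f z - p) < e"
    and \<delta>: "0 < \<delta>"
  shows "\<forall>\<^sub>F z in at 0. g z \<noteq> Infty \<and> norm (f z - p) < \<delta>"
proof (rule ccontr)
  assume "\<not> ?thesis"
  then have freq: "\<exists>z. 0 < norm z \<and> norm z < d \<and> \<not> (g z \<noteq> Infty \<and> norm (f z - p) < \<delta>)" if "0 < d" for d
    using that unfolding eventually_at by (auto simp: dist_norm)
  let ?S = "ball 0 1 - {0::complex}"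
  \<comment> \<open>With this choice \<open>(\<delta> - \<kappa>) * (\<delta> - \<kappa>)\<close> is
    49/64 of the square of \<delta>, and the boundary bound
    \<open>\<kappa> * (2 * \<delta> + \<kappa>)\<close> only 17/64.\<close>
  define \<kappa> where "\<kappa> = \<delta> / 8"
  have \<kappa>: "\<kappa> > 0" using \<delta> by (simp add: \<kappa>_def)
  obtain r0 where r0: "0 < r0" "r0 < 1" and
    osc: "\<And>z1 z2 :: complex. norm z1 = norm z2 \<Longrightarrow> 0 < norm z1 \<Longrightarrow> norm z1 < r0 \<Longrightarrow> g z1 \<noteq> Infty \<Longrightarrow> norm (f z1) \<le> norm p + \<delta> \<Longrightarrow>
       g z2 \<noteq> Infty \<and> norm (f z2 - f z1) < \<kappa>"
    using circle_oscillation[OF \<kappa>, of "norm p + \<delta>"] by blast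
  define \<Omega> where "\<Omega> = {z \<in> ?S. g z \<noteq> Infty \<and> norm (f z - p) < \<delta>}"
  have "open \<Omega>" unfolding \<Omega>_def by (rule open_sphere_preimage_ball[OF g])
  obtain z' where z': "0 < norm z'" "norm z' < r0" "z' \<notin> \<Omega>" using freq[OF r0(1)] by (auto simp: \<Omega>_def)
  obtain z1 where z1: "0 < norm z1" "norm z1 < norm z'" "g z1 \<noteq> Infty" "norm (f z1 - p) < \<kappa>"
    using cl[OF z'(1) \<kappa>] by blast
  obtain z'' where z'': "0 < norm z''" "norm z'' < norm z1" "z'' \<notin> \<Omega>"
    using freq[OF z1(1)] by (auto simp: \<Omega>_def)
  define r where "r = norm z1"
  have circ: "z \<in> \<Omega>" if "norm z = r" for z
  proof -
    have "norm (f z1) \<le> norm p + \<delta>"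
      using z1(4) \<delta> norm_triangle_sub[of "f z1" p] by (simp add: \<kappa>_def)
    then have "g z \<noteq> Infty \<and> norm (f z - f z1) < \<kappa>" using osc[of z1 z] z1 z' that by (simp add: r_def)
    moreover have "norm (f z - p) \<le> norm (f z - f z1) + norm (f z1 - p)"
      using norm_triangle_ineq[of "f z - f z1" "f z1 - p"] by simp
    ultimately show ?thesis using that z1 z' r0 \<delta> by (auto simp: \<Omega>_def r_def \<kappa>_def)
  qed
  \<comment> \<open>\<open>zs\<close> will be an outermost point off \<Omega> inside the circle of
    radius \<open>r\<close>, \<open>zt\<close> an innermost one outside it. As that circle lies in
    \<Omega>, so does the whole open annulus between their moduli.\<close>
  define Es where "Es = (cball 0 r - ball 0 (norm z'')) - \<Omega>"
  have "compact Es" unfolding Es_def using \<open>open \<Omega>\<close> by (intro compact_diff) auto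
  have "z'' \<in> Es" using z'' by (simp add: Es_def r_def)
  obtain zs where zs: "zs \<in> Es" "\<And>z. z \<in> Es \<Longrightarrow> norm z \<le> norm zs"
    using continuous_attains_sup[OF \<open>compact Es\<close> _ continuous_on_norm_id] \<open>z'' \<in> Es\<close> by blast
  define Et where "Et = (cball 0 (norm z') - ball 0 r) - \<Omega>"
  have "compact Et" unfolding Et_def using \<open>open \<Omega>\<close> by (intro compact_diff) auto
  have "z' \<in> Et" using z' z1 by (simp add: Et_def r_def)
  obtain zt where zt: "zt \<in> Et" "\<And>z. z \<in> Et \<Longrightarrow> norm zt \<le> norm z"
    using continuous_attains_inf[OF \<open>compact Et\<close> _ continuous_on_norm_id] \<open>z' \<in> Et\<close> by blast
  define s where "s = norm zs"
  define t where "t = norm zt"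
  have "s \<noteq> r" "t \<noteq> r" using zs(1) zt(1) circ[of zs] circ[of zt] by (auto simp: Es_def Et_def s_def t_def)
  then have s: "0 < s" "s < r" and t: "r < t" "t < r0"
    using zs(1) z'' zt(1) z' by (auto simp: Es_def Et_def s_def t_def)
  have ann: "z \<in> \<Omega>" if "s < norm z" "norm z < t" for z
  proof (rule ccontr)
    assume "z \<notin> \<Omega>"
    moreover have "norm z'' \<le> s" "t \<le> norm z'" using zs(1) zt(1) by (auto simp: Es_def Et_def s_def t_def)
    ultimately have "z \<in> Es \<or> z \<in> Et" using that by (auto simp: Es_def Et_def)
    then show False using zs(2)[of z] zt(2)[of z] that by (auto simp: s_def t_def)
  qed
  \<comment> \<open>Boundary points are approached along their radii from inside the annulus;
    \<open>F\<close> is the one-sided filter on the moduli.\<close>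
  have bnd: "g w \<noteq> Infty \<and> norm (f w - p) \<le> \<delta>"
    if F: "F \<le> at (norm w)" "F \<noteq> bot" "\<forall>\<^sub>F y in F. s < y \<and> y < t" and w: "0 < norm w" "norm w < 1" for w F
  proof -
    define \<gamma> where "\<gamma> y = of_real y * (w / of_real (norm w))" for y
    have n\<gamma>: "norm (\<gamma> y) = \<bar>y\<bar>" for y using w by (simp add: \<gamma>_def norm_mult norm_divide)
    have w\<gamma>: "\<gamma> (norm w) = w" using w by (simp add: \<gamma>_def)
    have "\<forall>\<^sub>F y in F. g (\<gamma> y) \<noteq> Infty \<and> norm (f (\<gamma> y) - p) \<le> \<delta>"
      using F(3)
    proof eventually_elim
      case (elim y)
      then show ?case using ann[of "\<gamma> y"] s n\<gamma>[of y] by (auto simp: \<Omega>_def)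
    qed
    moreover have "isCont \<gamma> (norm w)" unfolding \<gamma>_def by (intro continuous_intros) (use w in auto)
    ultimately show ?thesis
      using sphere_holomorphic_path_limit[OF g, of \<gamma> "norm w" F p \<delta>] w w\<gamma> F by auto
  qed
  \<comment> \<open>At most \<delta> as a limit from the annulus, at least \<delta> because
    \<open>zs\<close> is off \<Omega>.\<close>
  have fs: "g zs \<noteq> Infty" "norm (f zs - p) = \<delta>"
  proof -
    have "\<forall>\<^sub>F y in at_right s. s < y \<and> y < t"
      using eventually_at_right_real[of s t] s t by (auto elim: eventually_mono)
    then have "g zs \<noteq> Infty \<and> norm (f zs - p) \<le> \<delta>"
      using s t r0 by (intro bnd[of "at_right s"]) (auto simp: s_def[symmetric] intro: at_le)
    then show "g zs \<noteq> Infty" "norm (f zs - p) = \<delta>"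
      using zs(1) s t r0 by (auto simp: Es_def \<Omega>_def s_def)
  qed
  have ft: "g zt \<noteq> Infty" "norm (f zt - p) = \<delta>"
  proof -
    have "\<forall>\<^sub>F y in at_left t. s < y \<and> y < t"
      using eventually_at_left_real[of s t] s t by (auto elim: eventually_mono)
    then have "g zt \<noteq> Infty \<and> norm (f zt - p) \<le> \<delta>"
      using s t r0 by (intro bnd[of "at_left t"]) (auto simp: t_def[symmetric] intro: at_le)
    then show "g zt \<noteq> Infty" "norm (f zt - p) = \<delta>"
      using zt(1) s t r0 by (auto simp: Et_def \<Omega>_def t_def)
  qed
  have osc_s: "g z \<noteq> Infty \<and> norm (f z - f zs) < \<kappa>" if "norm z = s" for z
    using osc[of zs z] that s t fs norm_triangle_sub[of "f zs" p] by (simp add: s_def)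
  have osc_t: "g z \<noteq> Infty \<and> norm (f z - f zt) < \<kappa>" if "norm z = t" for z
  proof -
    have "zt \<noteq> 0" using s t by (auto simp: t_def)
    then show ?thesis using osc[of zt z] that s t ft norm_triangle_sub[of "f zt" p] by (simp add: t_def)
  qed
  define T where "T = cball 0 t \<inter> - ball (0::complex) s"
  define P where "P z = (f z - f zs) * (f z - f zt)" for z
  have TX: "T \<subseteq> {z \<in> ?S. g z \<noteq> Infty}"
  proof
    fix z assume "z \<in> T"
    then have z: "s \<le> norm z" "norm z \<le> t" by (auto simp: T_def)
    then have "z \<in> ?S" using s t r0 by auto
    moreover have "g z \<noteq> Infty"
      using z ann[of z] osc_s[of z] osc_t[of z] by (cases "norm z = s \<or> norm z = t") (auto simp: \<Omega>_def)
    ultimately show "z \<in> {z \<in> ?S. g z \<noteq> Infty}" by blast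
  qed
  then have holf: "f holomorphic_on T"
    using sphere_holomorphic_affine(2)[OF g] holomorphic_on_subset by blast
  then have holP: "P holomorphic_on T" unfolding P_def by (intro holomorphic_intros)
  have dst: "norm (f zs - f zt) \<le> 2 * \<delta>"
    using norm_triangle_ineq4[of "f zs - p" "f zt - p"] fs ft by simp
  have "norm (P z1) \<le> \<kappa> * (2 * \<delta> + \<kappa>)"
  proof (rule maximum_modulus_frontier[of P T])
    have "closed T" unfolding T_def by auto
    then show "continuous_on (closure T) P" using holP by (simp add: holomorphic_on_imp_continuous_on)
    show "P holomorphic_on interior T" using holP holomorphic_on_subset interior_subset by blast
    show "bounded T" unfolding T_def by (intro bounded_Int) auto
    show "z1 \<in> T" using s t by (auto simp: T_def r_def)
    fix z assume "z \<in> frontier T"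
    then have "z \<in> frontier (cball 0 t) \<union> frontier (- ball 0 s)"
      using frontier_Int_subset unfolding T_def by blast
    then consider "norm z = t" | "norm z = s" using s t by (auto simp: frontier_complement)
    then show "norm (P z) \<le> \<kappa> * (2 * \<delta> + \<kappa>)"
    proof cases
      case 1
      have "norm (f z - f zs) \<le> 2 * \<delta> + \<kappa>"
        using norm_triangle_ineq4[of "f z - f zt" "f zs - f zt"] dst osc_t[OF 1] by simp
      then have "norm (f z - f zs) * norm (f z - f zt) \<le> (2 * \<delta> + \<kappa>) * \<kappa>"
        using osc_t[OF 1] \<delta> \<kappa> by (intro mult_mono) auto
      then show ?thesis by (simp add: P_def norm_mult mult.commute)
    next
      case 2
      have "norm (f z - f zt) \<le> 2 * \<delta> + \<kappa>"
        using norm_triangle_ineq[of "f z - f zs" "f zs - f zt"] dst osc_s[OF 2] by simp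
      then have "norm (f z - f zs) * norm (f z - f zt) \<le> \<kappa> * (2 * \<delta> + \<kappa>)"
        using osc_s[OF 2] \<delta> \<kappa> by (intro mult_mono) auto
      then show ?thesis by (simp add: P_def norm_mult)
    qed
  qed
  moreover have "(\<delta> - \<kappa>) * (\<delta> - \<kappa>) \<le> norm (P z1)"
  proof -
    have "\<delta> - \<kappa> \<le> norm (f z1 - f zs)" "\<delta> - \<kappa> \<le> norm (f z1 - f zt)"
      using norm_triangle_ineq4[of "f z1 - p" "f z1 - f zs"] norm_triangle_ineq4[of "f z1 - p" "f z1 - f zt"]
        fs(2) ft(2) z1(4) by simp_all
    then show ?thesis using \<delta> unfolding P_def norm_mult by (intro mult_mono) (auto simp: \<kappa>_def)
  qed
  ultimately have "(\<delta> - \<kappa>) * (\<delta> - \<kappa>) \<le> \<kappa> * (2 * \<delta> + \<kappa>)" by linarith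
  then have "\<delta> * \<delta> \<le> 0" by (simp add: \<kappa>_def field_simps)
  then show False using \<delta> by (simp add: mult_le_0_iff)
qed

section \<open>Extension of the map over the puncture\<close>

lemma bounded_cluster:
  assumes "\<exists>\<^sub>F z in at 0. g z \<noteq> Infty \<and> norm (f z) \<le> M"
  obtains p where "\<And>d e. 0 < d \<Longrightarrow> 0 < e \<Longrightarrow> \<exists>z. 0 < norm z \<and> norm z < d \<and> g z \<noteq> Infty \<and> norm (f z - p) < e"
proof -
  have "\<exists>z. 0 < norm z \<and> norm z < 1 / Suc n \<and> g z \<noteq> Infty \<and> norm (f z) \<le> M" for n
  proof (rule ccontr)
    assume "\<not> ?thesis"
    then have "\<forall>\<^sub>F z in at 0. \<not> (g z \<noteq> Infty \<and> norm (f z) \<le> M)"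
      unfolding eventually_at by (intro exI[of _ "1 / Suc n"]) (auto simp: dist_norm)
    then show False using assms by (simp add: frequently_def)
  qed
  then obtain Z where Z: "\<And>n. 0 < norm (Z n)" "\<And>n. norm (Z n) < 1 / Suc n"
      "\<And>n. g (Z n) \<noteq> Infty" "\<And>n. norm (f (Z n)) \<le> M"
    by metis
  have "seq_compact (cball (0::complex) M)" using compact_cball compact_imp_seq_compact by blast
  then obtain p \<sigma> where \<sigma>: "strict_mono (\<sigma> :: nat \<Rightarrow> nat)" "((\<lambda>n. f (Z n)) \<circ> \<sigma>) \<longlonglongrightarrow> p"
    using Z(4) unfolding seq_compact_def by (metis mem_cball_0)
  show ?thesis
  proof (rule that[of p])
    fix d e :: real assume "0 < d" "0 < e"
    from \<open>0 < e\<close> \<sigma>(2) have 1: "\<forall>\<^sub>F n in sequentially. norm (f (Z (\<sigma> n)) - p) < e"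
      by (auto simp: tendsto_iff dist_norm)
    have "((\<lambda>n. 1 / real (Suc n)) \<longlonglongrightarrow> 0)" by (rule lim_1_over_n[THEN LIMSEQ_Suc])
    then have 2: "\<forall>\<^sub>F n in sequentially. 1 / real (Suc n) < d"
      using \<open>0 < d\<close> order_tendstoD(2) by blast
    obtain n where n: "norm (f (Z (\<sigma> n)) - p) < e" "1 / real (Suc n) < d"
      using eventually_happens[OF eventually_conj[OF 1 2]] by auto
    have "1 / real (Suc (\<sigma> n)) \<le> 1 / real (Suc n)"
      using seq_suble[OF \<sigma>(1), of n] by (intro divide_left_mono) auto
    then have "norm (Z (\<sigma> n)) < d" using Z(2)[of "\<sigma> n"] n(2) by linarith
    then show "\<exists>z. 0 < norm z \<and> norm z < d \<and> g z \<noteq> Infty \<and> norm (f z - p) < e"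
      using Z n by blast
  qed
qed

lemma puncture_extension:
  assumes "open V" "0 \<in> V" "V \<subseteq> ball 0 1"
    and "(Infty \<notin> (g(0 := v)) ` V \<and> (\<lambda>w. affine_chart ((g(0 := v)) w)) holomorphic_on V) \<or>
         (Cplx 0 \<notin> (g(0 := v)) ` V \<and> (\<lambda>w. infty_chart ((g(0 := v)) w)) holomorphic_on V)"
  shows "not_essential_puncture g"
  unfolding not_essential_puncture_def
proof (intro exI[of _ "g(0 := v)"] conjI ballI)
  show "sphere_holomorphic_on (g(0 := v)) (ball 0 1)"
    unfolding sphere_holomorphic_on_def
  proof
    fix z :: complex assume z: "z \<in> ball 0 1"
    show "\<exists>U. open U \<and> z \<in> U \<and> U \<subseteq> ball 0 1 \<and>
        (Infty \<notin> (g(0 := v)) ` U \<and> (\<lambda>w. affine_chart ((g(0 := v)) w)) holomorphic_on U \<or>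
         Cplx 0 \<notin> (g(0 := v)) ` U \<and> (\<lambda>w. infty_chart ((g(0 := v)) w)) holomorphic_on U)"
    proof (cases "z = 0")
      case True then show ?thesis using assms by blast
    next
      case False
      then obtain U where U: "open U" "z \<in> U" "U \<subseteq> ball 0 1 - {0}" and
        c: "(Infty \<notin> g ` U \<and> (\<lambda>w. affine_chart (g w)) holomorphic_on U) \<or>
         (Cplx 0 \<notin> g ` U \<and> (\<lambda>w. infty_chart (g w)) holomorphic_on U)"
        using g z unfolding sphere_holomorphic_on_def by blast
      have eq: "(g(0 := v)) w = g w" if "w \<in> U" for w using that U by auto
      have "(g(0 := v)) ` U = g ` U" using eq by (simp cong: image_cong)
      moreover have "(\<lambda>w. affine_chart ((g(0 := v)) w)) holomorphic_on U \<longleftrightarrow> (\<lambda>w. affine_chart (g w)) holomorphic_on U"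
        by (rule holomorphic_cong) (use U in auto)
      moreover have "(\<lambda>w. infty_chart ((g(0 := v)) w)) holomorphic_on U \<longleftrightarrow> (\<lambda>w. infty_chart (g w)) holomorphic_on U"
        by (rule holomorphic_cong) (use U in auto)
      ultimately show ?thesis using U c by (intro exI[of _ U]) auto
    qed
  qed
qed auto

text \<open>Either bounded values recur near 0, and a cluster value exists and is the limit, or
  every bound is eventually exceeded and g tends to infinity. Both cases end with Riemann's
  removable singularity theorem, in the affine chart or in the chart at infinity; the second
  includes g identically \<open>Infty\<close>.\<close>

lemma removable_puncture: "not_essential_puncture g"
proof (cases "\<exists>M. \<exists>\<^sub>F z in at 0. g z \<noteq> Infty \<and> norm (f z) \<le> M")
  case True
  then obtain p where p: "\<And>d e. 0 < d \<Longrightarrow> 0 < e \<Longrightarrow> \<exists>z. 0 < norm z \<and> norm z < d \<and> g z \<noteq> Infty \<and> norm (f z - p) < e"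
    using bounded_cluster by blast
  have lim: "\<forall>\<^sub>F z in at 0. g z \<noteq> Infty \<and> norm (f z - p) < \<delta>" if "0 < \<delta>" for \<delta>
    using cluster_value_is_limit[OF p that] by blast
  obtain d where d: "0 < d" "\<And>z. z \<noteq> 0 \<Longrightarrow> norm z < d \<Longrightarrow> g z \<noteq> Infty"
    using lim[of 1] unfolding eventually_at by auto
  define V where "V = ball (0::complex) (min d 1)"
  define h where "h = g(0 := Cplx p)"
  have "h w \<noteq> Infty" if "w \<in> V" for w using that d(2) by (auto simp: h_def V_def)
  then have "Infty \<notin> h ` V" by (metis imageE)
  moreover have "(\<lambda>w. affine_chart (h w)) holomorphic_on V"
  proof (rule no_isolated_singularity'[where K = "{0}"])
    have "f holomorphic_on (V - {0})"
      using sphere_holomorphic_affine(2)[OF g] by (rule holomorphic_on_subset) (use d in \<open>auto simp: V_def\<close>)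
    then show "(\<lambda>w. affine_chart (h w)) holomorphic_on (V - {0})"
      by (rule holomorphic_transform) (auto simp: h_def)
    have "(f \<longlongrightarrow> p) (at 0)"
      unfolding tendsto_iff dist_norm
    proof (intro allI impI)
      fix e :: real assume "0 < e"
      show "\<forall>\<^sub>F z in at 0. norm (f z - p) < e" using lim[OF \<open>0 < e\<close>] by eventually_elim simp
    qed
    then have "((\<lambda>w. affine_chart (h w)) \<longlongrightarrow> p) (at 0)"
      by (rule Lim_transform_eventually) (auto simp: h_def eventually_at_filter)
    then have "((\<lambda>w. affine_chart (h w)) \<longlongrightarrow> p) (at 0 within V)"
      by (rule tendsto_within_subset) simp
    moreover have "affine_chart (h 0) = p" by (simp add: h_def)
    ultimately show "((\<lambda>w. affine_chart (h w)) \<longlongrightarrow> affine_chart (h z)) (at z within V)" if "z \<in> {0}" for z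
      using that by simp
  qed (auto simp: V_def)
  ultimately show ?thesis
    using d(1) unfolding h_def by (intro puncture_extension[of V "Cplx p"]) (auto simp: V_def)
next
  case False
  then have lim: "\<forall>\<^sub>F z in at 0. \<not> (g z \<noteq> Infty \<and> norm (f z) \<le> M)" for M by (simp add: frequently_def)
  \<comment> \<open>The bound 0 says that g misses \<open>Cplx 0\<close> near the puncture, so the
    chart at infinity is usable on all of \<open>V\<close>.\<close>
  obtain d where d: "0 < d" "\<And>z. z \<noteq> 0 \<Longrightarrow> norm z < d \<Longrightarrow> \<not> (g z \<noteq> Infty \<and> norm (f z) \<le> 0)"
    using lim[of 0] unfolding eventually_at by auto
  then have d0: "g z \<noteq> Cplx 0" if "z \<noteq> 0" "norm z < d" for z using d(2)[OF that] by auto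
  define V where "V = ball (0::complex) (min d 1)"
  define h where "h = g(0 := Infty)"
  have "h w \<noteq> Cplx 0" if "w \<in> V" for w using that d0 by (auto simp: h_def V_def)
  then have "Cplx 0 \<notin> h ` V" by (metis imageE)
  moreover have "(\<lambda>w. infty_chart (h w)) holomorphic_on V"
  proof (rule no_isolated_singularity'[where K = "{0}"])
    have "(\<lambda>w. infty_chart (g w)) holomorphic_on (V - {0})"
      using sphere_holomorphic_infty(2)[OF g] by (rule holomorphic_on_subset) (use d0 in \<open>auto simp: V_def\<close>)
    then show "(\<lambda>w. infty_chart (h w)) holomorphic_on (V - {0})"
      by (rule holomorphic_transform) (auto simp: h_def)
    have "((\<lambda>w. infty_chart (g w)) \<longlongrightarrow> 0) (at 0)"
      unfolding tendsto_iff dist_norm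
    proof (intro allI impI)
      fix e :: real assume "0 < e"
      show "\<forall>\<^sub>F z in at 0. norm (infty_chart (g z) - 0) < e"
        using lim[of "1 / e"]
      proof eventually_elim
        case (elim z)
        show ?case
        proof (cases "g z")
          case (Cplx x)
          then have "1 / e < norm x" using elim by auto
          moreover from this have "norm x > 0" using \<open>0 < e\<close> by (meson divide_pos_pos less_trans zero_less_one)
          ultimately have "1 / norm x < e" using \<open>0 < e\<close> by (simp add: field_simps)
          then show ?thesis using Cplx by (simp add: norm_inverse divide_inverse)
        qed (use \<open>0 < e\<close> in simp)
      qed
    qed
    then have "((\<lambda>w. infty_chart (h w)) \<longlongrightarrow> 0) (at 0)"
      by (rule Lim_transform_eventually) (auto simp: h_def eventually_at_filter)
    then have "((\<lambda>w. infty_chart (h w)) \<longlongrightarrow> 0) (at 0 within V)"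
      by (rule tendsto_within_subset) simp
    moreover have "infty_chart (h 0) = 0" by (simp add: h_def)
    ultimately show "((\<lambda>w. infty_chart (h w)) \<longlongrightarrow> infty_chart (h z)) (at z within V)" if "z \<in> {0}" for z
      using that by simp
  qed (auto simp: V_def)
  ultimately show ?thesis
    using d(1) unfolding h_def by (intro puncture_extension[of V Infty]) (auto simp: V_def)
qed

end

section \<open>Totally ramified values\<close>

context cone_metric begin

text \<open>At these points \<open>pullback\<close> is 0 by definition and bounds no derivative. But
  \<open>b a > 0\<close> rules out order 1 in \<open>1 < n * (1 - b a)\<close>, so the root is
  multiple.\<close>

lemma ramified_deriv_eq_0:
  assumes g: "sphere_holomorphic_on g S" and ram: "ramified g S"
    and z: "z \<in> S" "a \<in> A" "g z = Cplx a"
  shows "deriv (\<lambda>w. affine_chart (g w)) z = 0"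
proof (cases "\<forall>\<^sub>F w in at z. g w = Cplx a")
  case True
  then have "\<forall>\<^sub>F w in nhds z. g w = Cplx a" using z(3) by (simp add: eventually_nhds_conv_at)
  then have "\<forall>\<^sub>F w in nhds z. affine_chart (g w) = a" by eventually_elim simp
  then have "deriv (\<lambda>w. affine_chart (g w)) z = deriv (\<lambda>w. a) z" by (intro deriv_cong_ev) auto
  then show ?thesis by simp
next
  case False
  let ?f = "\<lambda>w. affine_chart (g w)"
  define X where "X = {w \<in> S. g w \<noteq> Infty}"
  have X: "open X" "?f holomorphic_on X" "z \<in> X"
    unfolding X_def using sphere_holomorphic_affine[OF g] z by auto
  have ord: "1 < real_of_int (zorder (\<lambda>w. ?f w - a) z) * (1 - b a)"
    using ram z False unfolding ramified_def by blast
  have d: "deriv (\<lambda>w. ?f w - a) z = deriv ?f z"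
    using X by (subst deriv_diff) (auto intro: holomorphic_on_imp_differentiable_at)
  show ?thesis
  proof (rule ccontr)
    assume "deriv ?f z \<noteq> 0"
    then have "zorder (\<lambda>w. ?f w - a) z = 1"
      using X z d by (intro zorder_zero_eqI[of _ X]) (auto intro!: holomorphic_intros)
    then show False using ord b_pos[OF z(2)] by simp
  qed
qed

lemma not_essential_if_ramified:
  assumes g: "sphere_holomorphic_on g (ball 0 1 - {0})" and ram: "ramified g (ball 0 1 - {0})"
  shows "not_essential_puncture g"
proof -
  let ?S = "ball 0 1 - {0::complex}"
  obtain C where C: "\<And>z. z \<in> ?S \<Longrightarrow> pullback g z * norm z * (- ln (norm z)) \<le> C"
    using pullback_bound_punctured_disc[OF g ram] by blast
  interpret small_circles g
  proof
    fix M :: real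
    obtain c where c: "c > 0" "\<And>w. norm w \<le> M \<Longrightarrow> w \<notin> A \<Longrightarrow> c \<le> \<rho> w"
      using \<rho>_ge by blast
    have "norm (deriv (\<lambda>w. affine_chart (g w)) z) * norm z * (- ln (norm z)) \<le> \<bar>C\<bar> / c"
      if z: "z \<in> ?S" and fin: "g z \<noteq> Infty" and M: "norm (affine_chart (g z)) \<le> M" for z
    proof (cases "g z \<in> Cplx ` A")
      case True
      then have "deriv (\<lambda>w. affine_chart (g w)) z = 0" using ramified_deriv_eq_0[OF g ram z] by auto
      then show ?thesis using c by simp
    next
      case False
      then have "affine_chart (g z) \<notin> A" using fin by (cases "g z") auto
      then have "c * norm (deriv (\<lambda>w. affine_chart (g w)) z) \<le> pullback g z"
        using c(2)[OF M] False fin by (simp add: pullback_def mult_right_mono)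
      then have "c * norm (deriv (\<lambda>w. affine_chart (g w)) z) * (norm z * (- ln (norm z)))
          \<le> pullback g z * (norm z * (- ln (norm z)))"
        using z by (intro mult_right_mono mult_nonneg_nonneg) auto
      also have "\<dots> \<le> \<bar>C\<bar>" using C[OF z] by (simp add: mult.assoc)
      finally show ?thesis using c(1) by (simp add: field_simps)
    qed
    then show "\<exists>B. \<forall>z\<in>?S. g z \<noteq> Infty \<longrightarrow> norm (affine_chart (g z)) \<le> M \<longrightarrow>
      norm (deriv (\<lambda>w. affine_chart (g w)) z) * norm z * (- ln (norm z)) \<le> B" by blast
  qed (rule g)
  show ?thesis by (rule removable_puncture)
qed

end

text \<open>Bridges two conventions: \<open>root_multiplicity\<close> measures a pole in the affine
  chart, \<open>ramified\<close> in the chart at infinity.\<close>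

lemma zorder_infty_chart:
  assumes g: "sphere_holomorphic_on g S" and z: "z \<in> S" "g z = Infty"
    and nc: "\<not> (\<forall>\<^sub>F w in at z. g w = Infty)"
  shows "zorder (\<lambda>w. infty_chart (g w)) z > 0"
    "zorder (\<lambda>w. affine_chart (g w)) z = - zorder (\<lambda>w. infty_chart (g w)) z"
proof -
  define k where "k w = infty_chart (g w)" for w
  define X where "X = {w \<in> S. g w \<noteq> Cplx 0}"
  have X: "open X" "k holomorphic_on X" "z \<in> X"
    unfolding X_def k_def[abs_def] using sphere_holomorphic_infty[OF g] z by auto
  have "\<forall>\<^sub>F w in at z. w \<in> X"
    using eventually_nhds_in_open[OF X(1,3)] by (auto simp: eventually_at_filter elim: eventually_mono)
  moreover have "\<exists>\<^sub>F w in at z. g w \<noteq> Infty" using nc by (simp add: frequently_def)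
  ultimately have "\<exists>\<^sub>F w in at z. g w \<noteq> Infty \<and> w \<in> X"
    using frequently_eventually_frequently by blast
  then have freq: "\<exists>\<^sub>F w in at z. k w \<noteq> 0"
  proof (rule frequently_elim1)
    fix w assume "g w \<noteq> Infty \<and> w \<in> X"
    then show "k w \<noteq> 0" by (cases "g w") (auto simp: k_def X_def)
  qed
  obtain r where r: "r > 0" "ball z r \<subseteq> X" using X open_contains_ball by blast
  have "\<exists>w\<in>ball z r. k w \<noteq> 0"
  proof (rule ccontr)
    assume "\<not> ?thesis"
    then have "\<forall>\<^sub>F w in at z. \<not> k w \<noteq> 0"
      using r unfolding eventually_at by (auto simp: dist_commute intro!: exI[of _ r])
    then show False using freq by (simp add: frequently_def)
  qed
  moreover have "z \<in> ball z r" "k z = 0" using r z by (simp_all add: k_def)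
  ultimately have "zorder k z > 0"
    using zorder_exist_zero[OF holomorphic_on_subset[OF X(2) r(2)] open_ball connected_ball] by simp
  then show "zorder (\<lambda>w. infty_chart (g w)) z > 0" by (simp add: k_def[abs_def])
  have "isolated_singularity_at k z"
    using X by (intro isolated_singularity_at_holomorphic[of _ X]) (auto intro: holomorphic_on_subset)
  moreover have "not_essential k z" using X by (intro not_essential_holomorphic)
  ultimately have "zorder (\<lambda>w. inverse (k w)) z = - zorder k z"
    using freq by (intro zorder_inverse)
  then show "zorder (\<lambda>w. affine_chart (g w)) z = - zorder (\<lambda>w. infty_chart (g w)) z"
    by (simp add: k_def[abs_def] infty_chart_eq)
qed

text \<open>The existence of a root excludes \<open>\<mu> = \<infinity>\<close>. The truncation by
  \<open>nat\<close> in \<open>root_multiplicity\<close> loses nothing, since m is positive.\<close>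

lemma totally_ramified_multiplicity:
  assumes "totally_ramified_value g S \<alpha> \<mu>" "z \<in> S" "g z = \<alpha>" "\<not> (\<forall>\<^sub>F w in at z. g w = \<alpha>)" "2 \<le> \<mu>"
  obtains m where "\<mu> = enat m" "2 \<le> m"
    "\<And>a. \<alpha> = Cplx a \<Longrightarrow> int m \<le> zorder (\<lambda>w. affine_chart (g w) - a) z"
    "\<alpha> = Infty \<Longrightarrow> int m \<le> - zorder (\<lambda>w. affine_chart (g w)) z"
proof -
  have fin: "\<mu> \<noteq> \<infinity>"
  proof
    assume "\<mu> = \<infinity>"
    then have "\<forall>z\<in>S. g z \<noteq> \<alpha>" using assms(1) by (simp add: totally_ramified_value_def)
    then show False using assms(2,3) by blast
  qed
  then obtain m where m: "\<mu> = enat m" by (cases \<mu>) auto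
  then have "2 \<le> m" using assms(5) by (simp add: numeral_eq_enat)
  have "enat m \<le> root_multiplicity g \<alpha> z"
    using assms fin m by (auto simp: totally_ramified_value_def not_less)
  then show ?thesis
    using assms(4) m \<open>2 \<le> m\<close> by (intro that[OF m]) (auto simp: root_multiplicity_def)
qed

theorem corollary3p4:
  fixes q :: nat
    and \<alpha> :: "nat \<Rightarrow> riemann_sphere"
    and \<mu> :: "nat \<Rightarrow> enat"
    and g :: "complex \<Rightarrow> riemann_sphere"
  assumes "q > 0"
    and "inj_on \<alpha> {1..q}"
    and "\<And>j. j \<in> {1..q} \<Longrightarrow> \<mu> j \<ge> 2"
    and "(\<Sum>j=1..q. 1 - 1 / ereal_of_enat (\<mu> j)) > 2"
    and "sphere_holomorphic_on g (ball 0 1 - {0})"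
    and "\<And>j. j \<in> {1..q} \<Longrightarrow> totally_ramified_value g (ball 0 1 - {0}) (\<alpha> j) (\<mu> j)"
  shows "not_essential_puncture g"
proof -
  let ?S = "ball 0 1 - {0::complex}"
  \<comment> \<open>The real value of each summand, with 1 for an omitted value; the sum of extended
    reals becomes the real \<gamma>.\<close>
  define c where "c j = (case \<mu> j of enat m \<Rightarrow> 1 - 1 / real m | \<infinity> \<Rightarrow> 1)" for j
  have c_ereal: "1 - 1 / ereal_of_enat (\<mu> j) = ereal (c j)" if "j \<in> {1..q}" for j
    using assms(3)[OF that] by (cases "\<mu> j") (auto simp: c_def one_ereal_def numeral_eq_enat)
  have c_ge: "1 / 2 \<le> c j" if "j \<in> {1..q}" for j
    using assms(3)[OF that] by (cases "\<mu> j") (auto simp: c_def numeral_eq_enat field_simps)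
  have c_le: "c j \<le> 1" for j by (cases "\<mu> j") (auto simp: c_def)
  define \<gamma> where "\<gamma> = (\<Sum>j=1..q. c j)"
  have "(\<Sum>j=1..q. 1 - 1 / ereal_of_enat (\<mu> j)) = (\<Sum>j=1..q. ereal (c j))"
    by (intro sum.cong refl c_ereal)
  also have "\<dots> = ereal \<gamma>" by (simp add: \<gamma>_def)
  finally have "(\<Sum>j=1..q. 1 - 1 / ereal_of_enat (\<mu> j)) = ereal \<gamma>" .
  then have "\<gamma> > 2" using assms(4) less_ereal.simps(1)[of 2 \<gamma>] by simp
  \<comment> \<open>Omitted values have order \<open>\<infinity>\<close>, but any weight below 1 will do for them, so the loss \<open>\<eta>\<close> is the same everywhere.\<close>
  define \<eta> where "\<eta> = min (1 / 4) ((\<gamma> - 2) / (2 * (real q + 1)))"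
  have \<eta>: "0 < \<eta>" "\<eta> \<le> 1 / 4"
    unfolding \<eta>_def using \<open>\<gamma> > 2\<close> by (simp, intro min.cobounded1)
  \<comment> \<open>Each of the q weights loses \<eta>, and one more is lost when infinity is not a
    given value and \<beta> is \<open>- \<eta>\<close>. The cap 1/4 keeps the weights positive, as
    \<open>c j \<ge> 1 / 2\<close>.\<close>
  have "(real q + 1) * \<eta> \<le> (real q + 1) * ((\<gamma> - 2) / (2 * (real q + 1)))"
    by (intro mult_left_mono) (auto simp: \<eta>_def)
  also have "\<dots> = (\<gamma> - 2) / 2"
  proof -
    have "x * (y / (2 * x)) = y / 2" if "x > 0" for x y :: real using that by simp
    then show ?thesis by (simp only: of_nat_0_le_iff add_nonneg_pos zero_less_one)
  qed
  finally have \<eta>q: "(real q + 1) * \<eta> < \<gamma> - 2" using \<open>\<gamma> > 2\<close> by simp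
  \<comment> \<open>The second branch supplies \<beta> when infinity is not among the given
    values.\<close>
  define W where "W x = (if x \<in> \<alpha> ` {1..q} then c (inv_into {1..q} \<alpha> x) - \<eta> else - \<eta>)" for x
  have W\<alpha>: "W (\<alpha> j) = c j - \<eta>" if "j \<in> {1..q}" for j
    using that assms(2) by (simp add: W_def)
  have W_le: "\<eta> \<le> 1 - W x" for x
    using c_le \<eta> by (auto simp: W_def)
  define A where "A = {a. Cplx a \<in> \<alpha> ` {1..q}}"
  define b where "b a = W (Cplx a)" for a
  define \<beta> where "\<beta> = W Infty"
  have "finite A"
    using finite_vimageI[of "\<alpha> ` {1..q}" Cplx] by (simp add: A_def vimage_def inj_on_def)
  have CA: "Cplx ` A = \<alpha> ` {1..q} - {Infty}"
  proof (intro set_eqI)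
    fix x show "x \<in> Cplx ` A \<longleftrightarrow> x \<in> \<alpha> ` {1..q} - {Infty}" by (cases x) (auto simp: A_def)
  qed
  have "(\<Sum>x\<in>\<alpha> ` {1..q}. W x) = (\<Sum>j=1..q. c j - \<eta>)"
    using assms(2) W\<alpha> by (simp add: sum.reindex)
  then have sW: "(\<Sum>x\<in>\<alpha> ` {1..q}. W x) = \<gamma> - real q * \<eta>"
    by (simp add: sum_subtractf \<gamma>_def)
  have sb: "(\<Sum>a\<in>A. b a) = (\<Sum>x\<in>\<alpha> ` {1..q} - {Infty}. W x)"
    unfolding CA[symmetric] b_def by (subst sum.reindex) (auto simp: inj_on_def)
  have sum2: "(\<Sum>a\<in>A. b a) + \<beta> > 2"
  proof (cases "Infty \<in> \<alpha> ` {1..q}")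
    case True
    then have "(\<Sum>a\<in>A. b a) + \<beta> = \<gamma> - real q * \<eta>"
      unfolding sb \<beta>_def sW[symmetric] by (subst (2) sum.remove[of _ Infty]) auto
    then show ?thesis using \<eta>q \<eta> by (simp add: algebra_simps)
  next
    case False
    then have "(\<Sum>a\<in>A. b a) + \<beta> = \<gamma> - real q * \<eta> - \<eta>"
      unfolding sb sW[symmetric] by (simp add: \<beta>_def W_def)
    then show ?thesis using \<eta>q by (simp add: algebra_simps)
  qed
  \<comment> \<open>Infinity contributes at most 1, so a total above 2 requires a finite ramified
    value.\<close>
  have "\<beta> \<le> 1" using W_le[of Infty] \<eta> by (simp add: \<beta>_def)
  then have "A \<noteq> {}" using sum2 by auto
  \<comment> \<open>This is \<open>s_eq\<close> solved for \<open>s\<close>, with \<eta> in the role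
    of \<epsilon>; positivity is \<open>sum2\<close>.\<close>
  define s where "s = ((\<Sum>a\<in>A. b a) + \<beta> - 2) / (2 * \<eta> * card A)"
  interpret cone_metric A b \<beta> \<eta> s
  proof
    show "0 < b a" if a: "a \<in> A" for a
    proof -
      obtain j where "j \<in> {1..q}" "Cplx a = \<alpha> j" using a by (auto simp: A_def)
      then show ?thesis using W\<alpha>[of j] c_ge[of j] \<eta> by (simp add: b_def)
    qed
    show "\<eta> \<le> 1 - b a" for a using W_le by (simp add: b_def)
    show "\<eta> \<le> 1 - \<beta>" using W_le by (simp add: \<beta>_def)
    have "card A > 0" using \<open>finite A\<close> \<open>A \<noteq> {}\<close> by (simp add: card_gt_0_iff)
    then show "0 < s" "2 * \<eta> * s * card A = (\<Sum>a\<in>A. b a) + \<beta> - 2"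
      using sum2 \<eta> by (auto simp: s_def)
  qed fact+
  \<comment> \<open>For order m the product is 1 + m \<eta>, so the loss \<eta> is what makes the
    inequality strict.\<close>
  have mult: "1 < real_of_int n * (1 - (c j - \<eta>))"
    if "\<mu> j = enat m" "2 \<le> m" "int m \<le> n" for n j m
  proof -
    have "1 < real m * (1 / real m + \<eta>)" using that \<eta> by (simp add: algebra_simps)
    also have "\<dots> \<le> real_of_int n * (1 / real m + \<eta>)"
      using that \<eta> by (intro mult_right_mono) auto
    finally show ?thesis using that by (simp add: c_def)
  qed
  have "ramified g ?S"
    unfolding ramified_def
  proof (intro conjI ballI impI)
    fix z a assume z: "z \<in> ?S" and a: "a \<in> A" and gz: "g z = Cplx a"
    obtain j where j: "j \<in> {1..q}" "\<alpha> j = Cplx a" using a by (auto simp: A_def)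
    show "(\<forall>\<^sub>F w in at z. g w = Cplx a) \<or>
        1 < real_of_int (zorder (\<lambda>w. affine_chart (g w) - a) z) * (1 - b a)"
    proof (cases "\<forall>\<^sub>F w in at z. g w = Cplx a")
      case False
      with totally_ramified_multiplicity[OF assms(6)[OF j(1)] z _ _ assms(3)[OF j(1)]] gz j
      obtain m where "\<mu> j = enat m" "2 \<le> m" "int m \<le> zorder (\<lambda>w. affine_chart (g w) - a) z"
        by metis
      from mult[OF this] show ?thesis using W\<alpha>[OF j(1)] j(2) by (simp add: b_def)
    qed simp
  next
    fix z assume z: "z \<in> ?S" and gz: "g z = Infty"
    show "(\<forall>\<^sub>F w in at z. g w = Infty) \<or>
        1 < real_of_int (zorder (\<lambda>w. infty_chart (g w)) z) * (1 - \<beta>)"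
    proof (cases "\<forall>\<^sub>F w in at z. g w = Infty")
      case nc: False
      note ord = zorder_infty_chart[OF assms(5) z gz nc]
      show ?thesis
      proof (cases "Infty \<in> \<alpha> ` {1..q}")
        case True
        then obtain j where j: "j \<in> {1..q}" "\<alpha> j = Infty" by force
        with totally_ramified_multiplicity[OF assms(6)[OF j(1)] z _ _ assms(3)[OF j(1)]] gz nc
        obtain m where "\<mu> j = enat m" "2 \<le> m" "int m \<le> - zorder (\<lambda>w. affine_chart (g w)) z"
          by metis
        then have "int m \<le> zorder (\<lambda>w. infty_chart (g w)) z" using ord(2) by simp
        from mult[OF \<open>\<mu> j = enat m\<close> \<open>2 \<le> m\<close> this] show ?thesis
          using W\<alpha>[OF j(1)] j(2) by (simp add: \<beta>_def)
      next
        case False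
        \<comment> \<open>Here \<beta> equals \<open>- \<eta>\<close>, so a pole of order 1 already
          satisfies the condition.\<close>
        have "1 < 1 * (1 - \<beta>)" using False \<eta> by (simp add: \<beta>_def W_def)
        also have "\<dots> \<le> real_of_int (zorder (\<lambda>w. infty_chart (g w)) z) * (1 - \<beta>)"
          using ord(1) \<open>\<beta> \<le> 1\<close> by (intro mult_right_mono) auto
        finally show ?thesis by blast
      qed
    qed simp
  qed
  then show ?thesis by (rule not_essential_if_ramified[OF assms(5)])
qed

end
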